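(* Let $(X,d)$ be a metric space. Then $\operatorname{asrk}(X)$ is the supremum over $n\in\mathbb{N}$ for which there exist an $n$-dimensional normed space $V$, subsets $S_j\subset X$ and a sequence $R_j\to\infty$ such that $(S_j,R_j^{-1}d)$ converges in the Gromov-Hausdorff sense to $B(0,1)\subset V$, where $B(0,1)$ denotes the closed unit ball in $V$.
   Context: A metric space $(Z,d_Z)$ is an asymptotic subset of a metric space $(X,d)$ if there exist subsets $Z_j\subset X$ and $r_j\to\infty$ such that $(Z_j,r_j^{-1}d)$ converges to $(Z,d_Z)$ in the Gromov-Hausdorff sense. The asymptotic rank $\operatorname{asrk}(X)$ is the supremum of the $n\in\mathbb{N}$ for which there exist an asymptotic subset $Z$ of $X$ and a biLipschitz embedding $\varphi:K\to Z$ with $K\subset\mathbb{R}^n$ compact and $\mathcal{L}^n(K)>0$, where $\mathcal{L}^n$ is Lebesgue measure. Suprema over empty sets are $0$. *)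

theory Defs
  imports "HOL-Analysis.Analysis" "HOL-Analysis.Finite_Function_Topology"
begin

section \<open>Gromov-Hausdorff convergence\<close>

text \<open>
  The infimum of the empty set is \<^term>\<open>top :: ennreal\<close>, so the distance of sets that have no
  finite Hausdorff distance (in particular of the empty set and a nonempty set) is infinite.
\<close>

definition hausdorff_distance :: "('a \<Rightarrow> 'a \<Rightarrow> real) \<Rightarrow> 'a set \<Rightarrow> 'a set \<Rightarrow> ennreal" where
  "hausdorff_distance d A B =
     Inf {ennreal e |e. 0 < e \<and> (\<forall>a\<in>A. \<exists>b\<in>B. d a b < e) \<and> (\<forall>b\<in>B. \<exists>a\<in>A. d a b < e)}"

definition isometric_embedding ::
    "'a set \<Rightarrow> ('a \<Rightarrow> 'a \<Rightarrow> real) \<Rightarrow> 'b set \<Rightarrow> ('b \<Rightarrow> 'b \<Rightarrow> real) \<Rightarrow> ('a \<Rightarrow> 'b) \<Rightarrow> bool" where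
  "isometric_embedding A dA B dB f \<longleftrightarrow>
     f \<in> A \<rightarrow> B \<and> (\<forall>x\<in>A. \<forall>y\<in>A. dB (f x) (f y) = dA x y)"

text \<open>
  The infimum of the Hausdorff distances of isometric copies of \<open>A\<close> and \<open>B\<close> in a common metric
  space \<open>Y\<close>.  It is enough to let \<open>Y\<close> range over the metric spaces whose points are taken from the
  disjoint union of the two types: see \<open>gh_distance_le\<close> below.
\<close>

definition gh_distance ::
    "'a set \<Rightarrow> ('a \<Rightarrow> 'a \<Rightarrow> real) \<Rightarrow> 'b set \<Rightarrow> ('b \<Rightarrow> 'b \<Rightarrow> real) \<Rightarrow> ennreal" where
  "gh_distance A dA B dB =
     Inf {hausdorff_distance dY (f ` A) (g ` B) |(Y :: ('a + 'b) set) dY f g.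
            Metric_space Y dY \<and> isometric_embedding A dA Y dY f \<and> isometric_embedding B dB Y dY g}"

definition gh_converges ::
    "(nat \<Rightarrow> 'a set) \<Rightarrow> (nat \<Rightarrow> 'a \<Rightarrow> 'a \<Rightarrow> real) \<Rightarrow> 'b set \<Rightarrow> ('b \<Rightarrow> 'b \<Rightarrow> real) \<Rightarrow> bool" where
  "gh_converges A dA B dB \<longleftrightarrow> (\<lambda>j. gh_distance (A j) (dA j) B dB) \<longlonglongrightarrow> 0"

lemma gh_distance_le:
  fixes Y :: "'c set" and A :: "'a set" and B :: "'b set"
  assumes Y: "Metric_space Y dY"
    and f: "isometric_embedding A dA Y dY f" and g: "isometric_embedding B dB Y dY g"
  shows "gh_distance A dA B dB \<le> hausdorff_distance dY (f ` A) (g ` B)"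
proof -
  interpret Metric_space Y dY by fact
  define k where "k y = (if y \<in> f ` A then Inl (inv_into A f y) else Inr (inv_into B g y))" for y
  define p where "p = case_sum f g"
  have pk: "p (k y) = y" if "y \<in> f ` A \<union> g ` B" for y
    using that by (auto simp: p_def k_def f_inv_into_f)
  define Y' where "Y' = k ` (f ` A \<union> g ` B)"
  define d' where "d' u v = dY (p u) (p v)" for u v
  have sub: "f ` A \<union> g ` B \<subseteq> Y"
    using f g by (auto simp: isometric_embedding_def)
  have "Metric_space Y' d'"
  proof
    show "0 \<le> d' x y" for x y by (simp add: d'_def)
    show "d' x y = d' y x" for x y by (simp add: d'_def commute)
    show "d' x y = 0 \<longleftrightarrow> x = y" if xy: "x \<in> Y'" "y \<in> Y'" for x y
    proof -
      obtain u v where uv: "x = k u" "u \<in> f ` A \<union> g ` B" "y = k v" "v \<in> f ` A \<union> g ` B"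
        using xy unfolding Y'_def by blast
      then have "d' x y = dY u v" by (simp add: d'_def pk)
      moreover have "u \<in> Y" "v \<in> Y" using uv sub by blast+
      ultimately have "d' x y = 0 \<longleftrightarrow> u = v" by simp
      then show ?thesis using uv pk by metis
    qed
    show "d' x z \<le> d' x y + d' y z" if "x \<in> Y'" "y \<in> Y'" "z \<in> Y'" for x y z
    proof -
      have "p w \<in> Y" if "w \<in> Y'" for w
        using that sub pk unfolding Y'_def by force
      then show ?thesis using that by (simp add: d'_def triangle)
    qed
  qed
  moreover have "isometric_embedding A dA Y' d' (k \<circ> f)" "isometric_embedding B dB Y' d' (k \<circ> g)"
    using f g pk by (auto simp: isometric_embedding_def Y'_def d'_def)
  ultimately have "gh_distance A dA B dB \<le> hausdorff_distance d' ((k \<circ> f) ` A) ((k \<circ> g) ` B)"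
    unfolding gh_distance_def by (intro Inf_lower) blast
  also have "\<dots> = hausdorff_distance dY (f ` A) (g ` B)"
    unfolding hausdorff_distance_def d'_def by (simp add: pk)
  finally show ?thesis .
qed

section \<open>Asymptotic subsets and asymptotic rank\<close>

definition asymptotic_subset ::
    "'a set \<Rightarrow> ('a \<Rightarrow> 'a \<Rightarrow> real) \<Rightarrow> 'z set \<Rightarrow> ('z \<Rightarrow> 'z \<Rightarrow> real) \<Rightarrow> bool" where
  "asymptotic_subset X d Z dZ \<longleftrightarrow>
     Metric_space Z dZ \<and>
     (\<exists>(S :: nat \<Rightarrow> 'a set) (r :: nat \<Rightarrow> real).
        (\<forall>j. S j \<subseteq> X) \<and> (\<forall>j. 0 < r j) \<and> filterlim r at_top sequentially \<and>
        gh_converges S (\<lambda>j x y. inverse (r j) * d x y) Z dZ)"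

text \<open>
  Since the dimension \<open>n\<close> is a quantified variable, $\mathbb{R}^n$ is represented by the functions
  on \<^term>\<open>{..<n}\<close>, extended by \<^term>\<open>undefined\<close>: the topology is the product topology, the
  distance is Euclidean, and Lebesgue measure on Borel sets is the product measure.
\<close>

definition euclid_dist :: "nat \<Rightarrow> (nat \<Rightarrow> real) \<Rightarrow> (nat \<Rightarrow> real) \<Rightarrow> real" where
  "euclid_dist n x y = L2_set (\<lambda>i. x i - y i) {..<n}"

definition bilipschitz_embedding ::
    "'a set \<Rightarrow> ('a \<Rightarrow> 'a \<Rightarrow> real) \<Rightarrow> 'b set \<Rightarrow> ('b \<Rightarrow> 'b \<Rightarrow> real) \<Rightarrow> ('a \<Rightarrow> 'b) \<Rightarrow> bool" where
  "bilipschitz_embedding A dA B dB f \<longleftrightarrow>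
     f \<in> A \<rightarrow> B \<and>
     (\<exists>L>0. \<forall>x\<in>A. \<forall>y\<in>A. inverse L * dA x y \<le> dB (f x) (f y) \<and> dB (f x) (f y) \<le> L * dA x y)"

text \<open>
  The asymptotic subset \<open>Z\<close> has its points in the type \<^typ>\<open>nat \<Rightarrow> 'a\<close>.  Up to isometry this is
  no restriction: see \<open>asymptotic_subset_universe\<close> below.
\<close>

definition asrk :: "'a set \<Rightarrow> ('a \<Rightarrow> 'a \<Rightarrow> real) \<Rightarrow> enat" where
  "asrk X d =
     Sup {enat n |n. \<exists>(Z :: (nat \<Rightarrow> 'a) set) dZ (K :: (nat \<Rightarrow> real) set) \<phi>.
            asymptotic_subset X d Z dZ \<and>
            compactin (product_topology (\<lambda>_. euclideanreal) {..<n}) K \<and>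
            0 < emeasure (\<Pi>\<^sub>M i\<in>{..<n}. lborel) K \<and>
            bilipschitz_embedding K (euclid_dist n) Z dZ \<phi>}"

lemma gh_distance_less_imp_map:
  assumes "gh_distance A dA B dB < ennreal e"
  obtains p where "p \<in> B \<rightarrow> A"
    "\<And>z w. z \<in> B \<Longrightarrow> w \<in> B \<Longrightarrow> p z = p w \<Longrightarrow> dB z w < 2 * e"
proof -
  obtain Y :: "('a + 'b) set" and dY f g where Y: "Metric_space Y dY"
    and f: "isometric_embedding A dA Y dY f" and g: "isometric_embedding B dB Y dY g"
    and lt: "hausdorff_distance dY (f ` A) (g ` B) < ennreal e"
    using assms unfolding gh_distance_def Inf_less_iff by blast
  interpret Metric_space Y dY by fact
  obtain e' where e': "ennreal e' < ennreal e" "0 < e'" "\<forall>b\<in>g ` B. \<exists>a\<in>f ` A. dY a b < e'"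
    using lt unfolding hausdorff_distance_def Inf_less_iff by blast
  then have "e' < e" by (simp add: ennreal_less_iff)
  then have "\<forall>z\<in>B. \<exists>a\<in>A. dY (f a) (g z) < e" using e' by force
  then obtain p where p: "\<And>z. z \<in> B \<Longrightarrow> p z \<in> A \<and> dY (f (p z)) (g z) < e" by metis
  have "dB z w < 2 * e" if "z \<in> B" "w \<in> B" "p z = p w" for z w
  proof -
    have Yin: "g z \<in> Y" "g w \<in> Y" "f (p z) \<in> Y"
      using f g that p by (auto simp: isometric_embedding_def)
    have "dB z w = dY (g z) (g w)" using g that by (simp add: isometric_embedding_def)
    also have "\<dots> \<le> dY (g z) (f (p z)) + dY (f (p z)) (g w)" using Yin by (intro triangle)
    also have "\<dots> < 2 * e" using p[OF that(1)] p[OF that(2)] that(3) by (simp add: commute)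
    finally show ?thesis .
  qed
  with p that show ?thesis by blast
qed

lemma asymptotic_subset_universe:
  fixes X :: "'a set" and Z :: "'z set"
  assumes Z: "asymptotic_subset X d Z dZ"
  obtains h :: "'z \<Rightarrow> nat \<Rightarrow> 'a" and dZ' where
    "asymptotic_subset X d (h ` Z) dZ'" "isometric_embedding Z dZ (h ` Z) dZ' h"
proof -
  obtain S r where S: "\<forall>j. S j \<subseteq> X" "\<forall>j. 0 < r j" "filterlim r at_top sequentially"
    and lim: "gh_converges S (\<lambda>j x y. inverse (r j) * d x y) Z dZ"
    using Z unfolding asymptotic_subset_def by blast
  interpret Z: Metric_space Z dZ using Z by (simp add: asymptotic_subset_def)
  have "\<exists>p :: 'z \<Rightarrow> 'a. \<forall>z\<in>Z. \<forall>w\<in>Z. p z = p w \<longrightarrow> dZ z w < 2 * inverse (real (Suc k))" for k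
  proof -
    have "eventually (\<lambda>j. gh_distance (S j) (\<lambda>x y. inverse (r j) * d x y) Z dZ
            < ennreal (inverse (real (Suc k)))) sequentially"
      using lim unfolding gh_converges_def by (rule order_tendstoD) simp
    then obtain j where
      "gh_distance (S j) (\<lambda>x y. inverse (r j) * d x y) Z dZ < ennreal (inverse (real (Suc k)))"
      unfolding eventually_sequentially by blast
    then show ?thesis by (rule gh_distance_less_imp_map) blast
  qed
  then obtain p :: "nat \<Rightarrow> 'z \<Rightarrow> 'a" where
    p: "\<And>k z w. z \<in> Z \<Longrightarrow> w \<in> Z \<Longrightarrow> p k z = p k w \<Longrightarrow> dZ z w < 2 * inverse (real (Suc k))"
    by metis
  define h where "h z k = p k z" for z k
  have inj: "inj_on h Z"
  proof (rule inj_onI)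
    fix z w assume zw: "z \<in> Z" "w \<in> Z" "h z = h w"
    then have lt: "dZ z w < 2 * inverse (real (Suc k))" for k
      by (intro p) (auto simp: h_def dest: fun_cong)
    show "z = w"
    proof (rule ccontr)
      assume "z \<noteq> w"
      with zw have "0 < dZ z w / 2" by simp
      then obtain k where "inverse (real (Suc k)) < dZ z w / 2" using reals_Archimedean by blast
      with lt[of k] show False by simp
    qed
  qed
  define q where "q = inv_into Z h"
  have q: "q (h z) = z" if "z \<in> Z" for z using inj that by (simp add: q_def)
  define dZ' where "dZ' u v = dZ (q u) (q v)" for u v
  have met: "Metric_space (h ` Z) dZ'"
    by unfold_locales (auto simp: dZ'_def q Z.commute Z.triangle)
  have "gh_distance A dA (h ` Z) dZ' \<le> gh_distance A dA Z dZ"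
    for A :: "'a set" and dA
    unfolding gh_distance_def[of A dA Z dZ]
  proof (rule Inf_greatest, clarify)
    fix Y :: "('a + 'z) set" and dY f g
    assume Y: "Metric_space Y dY" and f: "isometric_embedding A dA Y dY f"
      and g: "isometric_embedding Z dZ Y dY g"
    have "isometric_embedding (h ` Z) dZ' Y dY (g \<circ> q)"
      using g by (auto simp: isometric_embedding_def dZ'_def q)
    from gh_distance_le[OF Y f this]
    have "gh_distance A dA (h ` Z) dZ' \<le> hausdorff_distance dY (f ` A) ((g \<circ> q) ` h ` Z)" .
    moreover have "(g \<circ> q) ` h ` Z = g ` Z" by (auto simp: q image_iff)
    ultimately show "gh_distance A dA (h ` Z) dZ' \<le> hausdorff_distance dY (f ` A) (g ` Z)" by simp
  qed
  then have "gh_converges S (\<lambda>j x y. inverse (r j) * d x y) (h ` Z) dZ'"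
    using lim unfolding gh_converges_def
    by (intro tendsto_sandwich[OF _ _ tendsto_const lim[unfolded gh_converges_def]]) auto
  with met S have "asymptotic_subset X d (h ` Z) dZ'" unfolding asymptotic_subset_def by blast
  moreover have "isometric_embedding Z dZ (h ` Z) dZ' h"
    by (auto simp: isometric_embedding_def dZ'_def q)
  ultimately show ?thesis by (rule that)
qed

section \<open>Finite-dimensional normed spaces\<close>

text \<open>
  A normed space is a linear subspace \<open>V\<close> of some real vector space together with a norm \<open>N\<close> on
  \<open>V\<close>, of which only the values on \<open>V\<close> matter.  The dimension is given by a finite basis because
  \<^const>\<open>dim\<close> is \<open>0\<close> for infinite-dimensional spaces.
\<close>

definition normed_space_of_dim :: "nat \<Rightarrow> 'v::real_vector set \<Rightarrow> ('v \<Rightarrow> real) \<Rightarrow> bool" where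
  "normed_space_of_dim n V N \<longleftrightarrow>
     subspace V \<and> (\<exists>B. finite B \<and> independent B \<and> span B = V \<and> card B = n) \<and>
     (\<forall>x\<in>V. 0 \<le> N x) \<and> (\<forall>x\<in>V. N x = 0 \<longleftrightarrow> x = 0) \<and>
     (\<forall>x\<in>V. \<forall>a. N (a *\<^sub>R x) = \<bar>a\<bar> * N x) \<and>
     (\<forall>x\<in>V. \<forall>y\<in>V. N (x + y) \<le> N x + N y)"

definition closed_unit_ball :: "'v::real_vector set \<Rightarrow> ('v \<Rightarrow> real) \<Rightarrow> 'v set" where
  "closed_unit_ball V N = {x \<in> V. N x \<le> 1}"

text \<open>
  Every \<open>n\<close>-dimensional normed space is linearly isometric to one inside the space of finitely
  supported real sequences, so quantifying over such spaces inside a formula loses nothing.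
\<close>

lemma normed_space_of_dim_universe:
  fixes V :: "'v::real_vector set"
  assumes V: "normed_space_of_dim n V N"
  obtains T :: "'v \<Rightarrow> (nat \<Rightarrow>\<^sub>0 real)" and N' where
    "linear T" "inj_on T V" "normed_space_of_dim n (T ` V) N'" "\<And>x. x \<in> V \<Longrightarrow> N' (T x) = N x"
proof -
  note V' = V[unfolded normed_space_of_dim_def]
  from V' have sub: "subspace V" by (rule conjunct1)
  have nonneg: "0 \<le> N x" and zero: "N x = 0 \<longleftrightarrow> x = 0" and scale: "N (a *\<^sub>R x) = \<bar>a\<bar> * N x"
    if "x \<in> V" for x a
    using V' that by simp_all
  have triangle: "N (x + y) \<le> N x + N y" if "x \<in> V" "y \<in> V" for x y
    using V' that by simp
  obtain B where B: "finite B" "independent B" "span B = V" "card B = n"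
    using conjunct1[OF conjunct2[OF V']] by (elim exE conjE)
  obtain i :: "'v \<Rightarrow> nat" where i: "inj_on i B"
    using B(1) finite_imp_inj_to_nat_seg by blast
  define e :: "nat \<Rightarrow> (nat \<Rightarrow>\<^sub>0 real)" where "e k = Poly_Mapping.single k 1" for k
  obtain T :: "'v \<Rightarrow> (nat \<Rightarrow>\<^sub>0 real)" where T: "linear T" "\<And>b. b \<in> B \<Longrightarrow> T b = e (i b)"
    using linear_independent_extend[OF B(2), of "\<lambda>b. e (i b)"] by blast
  have lookup: "Poly_Mapping.lookup (a *\<^sub>R x) k = a * Poly_Mapping.lookup x k"
    for a k and x :: "nat \<Rightarrow>\<^sub>0 real"
  proof -
    have "finite {j. a *\<^sub>R Poly_Mapping.lookup x j \<noteq> 0}"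
      by (rule finite_subset[OF _ finite_keys[of x]]) (auto simp: in_keys_iff)
    then show ?thesis by (simp add: scaleR_poly_mapping_def)
  qed
  have inj: "inj_on T V"
  proof -
    have "x = 0" if "x \<in> V" "T x = 0" for x
    proof -
      obtain c where x: "x = (\<Sum>b\<in>B. c b *\<^sub>R b)"
        using \<open>x \<in> V\<close> unfolding B(3)[symmetric] span_finite[OF B(1)] by blast
      have "c b = 0" if b: "b \<in> B" for b
      proof -
        have "0 = Poly_Mapping.lookup (T x) (i b)" using \<open>T x = 0\<close> by simp
        also have "\<dots> = (\<Sum>a\<in>B. c a * Poly_Mapping.lookup (e (i a)) (i b))"
          by (simp add: x linear_sum[OF T(1)] linear_scale[OF T(1)] T(2) lookup_sum lookup)
        also have "\<dots> = (\<Sum>a\<in>B. if a = b then c a else 0)"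
          using i b by (intro sum.cong) (auto simp: e_def lookup_single when_def inj_on_def)
        finally show ?thesis using b B(1) by simp
      qed
      then show ?thesis by (simp add: x)
    qed
    note * = this
    show ?thesis
    proof (rule inj_onI)
      fix x y assume xy: "x \<in> V" "y \<in> V" "T x = T y"
      then have "x - y \<in> V" by (intro subspace_diff sub)
      moreover have "T (x - y) = 0" using xy(3) by (simp add: linear_diff[OF T(1)])
      ultimately have "x - y = 0" by (rule *)
      then show "x = y" by simp
    qed
  qed
  define N' where "N' y = N (inv_into V T y)" for y
  have N': "N' (T x) = N x" if "x \<in> V" for x using inj that by (simp add: N'_def)
  have "\<exists>C. finite C \<and> independent C \<and> span C = T ` V \<and> card C = n"
  proof (intro exI conjI)
    show "finite (T ` B)" using B(1) by simp
    show "independent (T ` B)"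
      using linear_independent_injective_image[OF T(1) B(2)] inj B(3) by simp
    show "span (T ` B) = T ` V" using linear_span_image[OF T(1), of B] B(3) by simp
    have "B \<subseteq> V" using span_superset B(3) by blast
    then show "card (T ` B) = n"
      using card_image inj_on_subset[OF inj] B(4) by blast
  qed
  moreover have "subspace (T ` V)" by (rule linear_subspace_image[OF T(1) sub])
  moreover have "N' y = 0 \<longleftrightarrow> y = 0" if "y \<in> T ` V" for y
  proof -
    obtain x where x: "y = T x" "x \<in> V" using \<open>y \<in> T ` V\<close> by blast
    have "x = 0 \<longleftrightarrow> T x = T 0" using inj_on_eq_iff[OF inj x(2) subspace_0[OF sub]] by simp
    then show ?thesis using x N'[of x] zero[of x] by (simp add: linear_0[OF T(1)])
  qed
  moreover have "N' (a *\<^sub>R y) = \<bar>a\<bar> * N' y" if "y \<in> T ` V" for a y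
  proof -
    obtain x where x: "y = T x" "x \<in> V" using \<open>y \<in> T ` V\<close> by blast
    have "N' (T (a *\<^sub>R x)) = \<bar>a\<bar> * N' (T x)"
      using x(2) N'[OF x(2)] N'[OF subspace_scale[OF sub x(2)]] scale by simp
    then show ?thesis by (simp add: x(1) linear_scale[OF T(1)])
  qed
  moreover have "N' (y + z) \<le> N' y + N' z" if "y \<in> T ` V" "z \<in> T ` V" for y z
  proof -
    obtain v w where vw: "y = T v" "v \<in> V" "z = T w" "w \<in> V" using \<open>y \<in> T ` V\<close> \<open>z \<in> T ` V\<close> by blast
    have "N' (T (v + w)) \<le> N' (T v) + N' (T w)"
      using N'[OF vw(2)] N'[OF vw(4)] N'[OF subspace_add[OF sub vw(2,4)]] triangle[OF vw(2,4)]
      by simp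
    then show ?thesis by (simp add: vw linear_add[OF T(1)])
  qed
  moreover have "0 \<le> N' y" if "y \<in> T ` V" for y
    using that N' nonneg by auto
  ultimately have "normed_space_of_dim n (T ` V) N'"
    unfolding normed_space_of_dim_def by (intro conjI ballI allI) simp_all
  then show ?thesis using T(1) inj N' by (intro that)
qed

end

theory Submission
  imports Defs
begin

text \<open>
  Both suprema run over the same set of dimensions.

  The unit ball of an \<open>n\<close>-dimensional normed space is itself an asymptotic subset as soon as it is
  a limit of rescaled subsets of \<open>X\<close>, and a small cube in coordinates with respect to a basis embeds
  into it biLipschitzly because all norms in finite dimension are equivalent
  (\<open>ball_limit_imp_bilipschitz_image\<close>).

  For the converse one usually differentiates the metric that \<open>\<phi>\<close> pulls back to \<open>K\<close>: by Kirchheim's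
  theorem it is infinitesimally a norm at almost every point.  Since every asymptotic subset and every
  rescaling of it is again seen in \<open>X\<close> at large scales, it is enough to produce \<^emph>\<open>some\<close> norm that
  is visible in \<open>X\<close>, and that can be done by compactness.
  Consider the set \<open>C\<close> of all pseudometrics \<open>\<rho>\<close> on \<open>\<real>\<^sup>n\<close> that are \<open>L\<close>-biLipschitz to the Euclidean
  one and whose restriction to every finite set is approximated by finite subsets of \<open>X\<close> with
  the metric divided by arbitrarily large factors.

  \<^item> \<open>C\<close> is compact for pointwise convergence and invariant under pulling back by homotheties
    \<open>x \<mapsto> a + s x\<close> and dividing by \<open>s\<close>.

  \<^item> \<open>C\<close> is nonempty: a set of positive measure contains a homothetic copy of every finite set
    (\<open>positive_measure_contains_homothetic_copy\<close>), so for each finite \<open>F\<close> the pullback of the metric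
    satisfies the conditions concerning \<open>F\<close>, and these conditions have the finite intersection property.

  \<^item> A minimal nonempty closed invariant subset \<open>M\<close> of \<open>C\<close> consists of norms
    (\<open>exists_homogeneous_element\<close>).  Fix a vector \<open>v\<close> and let \<open>m\<close> be the largest value of
    \<open>\<rho> (0, v)\<close> on \<open>M\<close>.  By invariance, \<open>\<rho> (x, x + t v) \<le> t m\<close> throughout \<open>M\<close>.  An element attaining
    the maximum, rescaled, is extremal on one very long segment; by the triangle inequality
    the total deficit along a parallel segment is bounded independently of the length, so
    somewhere there is a long stretch on which the deficit of finitely many parallel
    segments is tiny.  By compactness some element of \<open>M\<close> satisfies
    \<open>\<rho> (x, x + t v) = t m\<close> for all \<open>x\<close> and \<open>t \<ge> 0\<close>.  This condition is closed and invariant, so by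
    minimality it holds on all of \<open>M\<close>.

  Finally, the unit ball of a norm \<open>N\<close> obtained in this way is totally bounded, so approximations of its finite
  nets by subsets of \<open>X\<close> give Gromov-Hausdorff convergence (\<open>approximable_ball_is_limit\<close>).
\<close>

section \<open>Gromov-Hausdorff distance and almost isometries\<close>

text \<open>
  The pointwise formula \<open>N (v - w)\<close> for the metric of a ball is a metric in the sense of
  \<^locale>\<open>Metric_space\<close> only after its values off the subspace have been changed.
\<close>

lemma gh_distance_cong:
  fixes A :: "'a set" and B :: "'b set"
  assumes "\<And>x y. x \<in> B \<Longrightarrow> y \<in> B \<Longrightarrow> dB x y = dB' x y"
  shows "gh_distance A dA B dB = gh_distance A dA B dB'"
proof -
  have "isometric_embedding B dB Y dY g \<longleftrightarrow> isometric_embedding B dB' Y dY g"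
    for Y :: "('a + 'b) set" and dY g
    using assms by (auto simp: isometric_embedding_def)
  then show ?thesis by (simp add: gh_distance_def)
qed

text \<open>
  Send each point of \<open>B\<close> to a nearby point of \<open>A\<close> in a common ambient space; two
  displacements by less than \<open>e\<close> change a distance by less than \<open>2 * e\<close>.
\<close>

lemma gh_distance_less_imp_almost_isometry:
  assumes "gh_distance A dA B dB < ennreal e"
  obtains p where "p \<in> B \<rightarrow> A"
    "\<And>z w. z \<in> B \<Longrightarrow> w \<in> B \<Longrightarrow> \<bar>dA (p z) (p w) - dB z w\<bar> < 2 * e"
proof -
  obtain Y :: "('a + 'b) set" and dY f g where Y: "Metric_space Y dY"
    and f: "isometric_embedding A dA Y dY f" and g: "isometric_embedding B dB Y dY g"
    and lt: "hausdorff_distance dY (f ` A) (g ` B) < ennreal e"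
    using assms unfolding gh_distance_def Inf_less_iff by blast
  interpret Metric_space Y dY by fact
  obtain e' where e': "ennreal e' < ennreal e" "0 < e'" "\<forall>b\<in>g ` B. \<exists>a\<in>f ` A. dY a b < e'"
    using lt unfolding hausdorff_distance_def Inf_less_iff by blast
  then have "e' < e" by (simp add: ennreal_less_iff)
  then have "\<forall>z\<in>B. \<exists>a\<in>A. dY (f a) (g z) < e" using e' by force
  then obtain p where p: "\<And>z. z \<in> B \<Longrightarrow> p z \<in> A \<and> dY (f (p z)) (g z) < e" by metis
  have "\<bar>dA (p z) (p w) - dB z w\<bar> < 2 * e" if zw: "z \<in> B" "w \<in> B" for z w
  proof -
    have Yin: "g z \<in> Y" "g w \<in> Y" "f (p z) \<in> Y" "f (p w) \<in> Y"
      using f g zw p by (auto simp: isometric_embedding_def)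
    have dA: "dA (p z) (p w) = dY (f (p z)) (f (p w))" and dB: "dB z w = dY (g z) (g w)"
      using f g p zw by (auto simp: isometric_embedding_def)
    have "dY (f (p z)) (f (p w)) \<le> dY (f (p z)) (g z) + dY (g z) (g w) + dY (g w) (f (p w))"
      using triangle[of "f (p z)" "g z" "f (p w)"] triangle[of "g z" "g w" "f (p w)"] Yin by linarith
    moreover have "dY (g z) (g w) \<le> dY (g z) (f (p z)) + dY (f (p z)) (f (p w)) + dY (f (p w)) (g w)"
      using triangle[of "g z" "f (p z)" "g w"] triangle[of "f (p z)" "f (p w)" "g w"] Yin by linarith
    ultimately show ?thesis
      using p[OF zw(1)] p[OF zw(2)] commute[of "g z" "f (p z)"] commute[of "g w" "f (p w)"]
      unfolding dA dB by linarith
  qed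
  with p that show ?thesis by blast
qed

text \<open>
  The disjoint union becomes a metric space in which related points have distance at most \<open>e\<close>, by
  letting the paths from one side to the other pass through a related pair at the cost \<open>e\<close>.  The
  bound on the distortion says precisely that such a detour through the other side never shortens
  a distance.  Since the Hausdorff distance is defined by strict inequalities, the bound \<open>2 * e\<close>
  leaves some room.
\<close>

lemma gh_distance_le_correspondence:
  fixes A :: "'a set" and B :: "'b set"
  assumes A: "Metric_space A dA" and B: "Metric_space B dB"
    and C: "C \<subseteq> A \<times> B" "fst ` C = A" "snd ` C = B" "C \<noteq> {}"
    and e: "0 < e"
    and distortion: "\<And>a b a' b'. (a, b) \<in> C \<Longrightarrow> (a', b') \<in> C \<Longrightarrow> \<bar>dA a a' - dB b b'\<bar> \<le> 2 * e"
  shows "gh_distance A dA B dB \<le> ennreal (2 * e)"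
proof -
  interpret A: Metric_space A dA by fact
  interpret B: Metric_space B dB by fact
  define cross where "cross a b = (INF p\<in>C. dA a (fst p) + e + dB (snd p) b)" for a b
  have cross_le: "cross a b \<le> dA a a' + e + dB b' b" if "(a', b') \<in> C" for a b a' b'
    unfolding cross_def using cINF_lower[OF _ that, of "\<lambda>p. dA a (fst p) + e + dB (snd p) b"] e
    by (simp add: bdd_belowI2[where m = 0])
  have cross_ge: "x \<le> cross a b"
    if "\<And>a' b'. (a', b') \<in> C \<Longrightarrow> x \<le> dA a a' + e + dB b' b" for x a b
    unfolding cross_def using that C(4) by (intro cINF_greatest) auto
  have cross_pos: "e \<le> cross a b" for a b by (rule cross_ge) simp
  have CA: "a \<in> A" "b \<in> B" if "(a, b) \<in> C" for a b using C(1) that by auto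
  have AAB: "cross a b \<le> dA a x + cross x b" if "a \<in> A" "x \<in> A" for a x b
  proof -
    have "cross a b - dA a x \<le> cross x b"
    proof (rule cross_ge)
      fix a' b' assume p: "(a', b') \<in> C"
      show "cross a b - dA a x \<le> dA x a' + e + dB b' b"
        using cross_le[OF p, of a b] A.triangle[of a x a'] that CA[OF p] by linarith
    qed
    then show ?thesis by simp
  qed
  have ABB: "cross a b \<le> cross a y + dB y b" if "b \<in> B" "y \<in> B" for a b y
  proof -
    have "cross a b - dB y b \<le> cross a y"
    proof (rule cross_ge)
      fix a' b' assume p: "(a', b') \<in> C"
      show "cross a b - dB y b \<le> dA a a' + e + dB b' y"
        using cross_le[OF p, of a b] B.triangle[of b' y b] that CA[OF p] by linarith
    qed
    then show ?thesis by simp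
  qed
  have ABA: "dA a x \<le> cross a b + cross x b" if "a \<in> A" "x \<in> A" "b \<in> B" for a x b
  proof -
    have "dA a x - cross a b \<le> cross x b"
    proof (rule cross_ge)
      fix a' b' assume p: "(a', b') \<in> C"
      have "dA a x - (dA x a' + e + dB b' b) \<le> cross a b"
      proof (rule cross_ge)
        fix a'' b'' assume p': "(a'', b'') \<in> C"
        show "dA a x - (dA x a' + e + dB b' b) \<le> dA a a'' + e + dB b'' b"
          using A.triangle[of a a'' x] A.triangle[of a'' a' x] B.triangle[of b'' b b']
            distortion[OF p' p] that CA[OF p] CA[OF p'] A.commute[of x a'] B.commute[of b b']
          by linarith
      qed
      then show "dA a x - cross a b \<le> dA x a' + e + dB b' b" by simp
    qed
    then show ?thesis by simp
  qed
  have BAB: "dB b y \<le> cross a b + cross a y" if "a \<in> A" "b \<in> B" "y \<in> B" for a b y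
  proof -
    have "dB b y - cross a b \<le> cross a y"
    proof (rule cross_ge)
      fix a' b' assume p: "(a', b') \<in> C"
      have "dB b y - (dA a a' + e + dB b' y) \<le> cross a b"
      proof (rule cross_ge)
        fix a'' b'' assume p': "(a'', b'') \<in> C"
        show "dB b y - (dA a a' + e + dB b' y) \<le> dA a a'' + e + dB b'' b"
          using B.triangle[of b b'' y] B.triangle[of b'' b' y] A.triangle[of a'' a a']
            distortion[OF p' p] that CA[OF p] CA[OF p'] A.commute[of a a''] B.commute[of b b'']
          by linarith
      qed
      then show "dB b y - cross a b \<le> dA a a' + e + dB b' y" by simp
    qed
    then show ?thesis by simp
  qed
  have AAB': "cross a b \<le> cross x b + dA x a" if "a \<in> A" "x \<in> A" for a x b
    using AAB[OF that, of b] by (simp add: A.commute add.commute)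
  have ABB': "cross a b \<le> dB b y + cross a y" if "b \<in> B" "y \<in> B" for a b y
    using ABB[OF that, of a] by (simp add: B.commute add.commute)
  define Y where "Y = Inl ` A \<union> Inr ` B"
  define dY where "dY u v = (case u of
      Inl a \<Rightarrow> (case v of Inl a' \<Rightarrow> dA a a' | Inr b \<Rightarrow> cross a b)
    | Inr b \<Rightarrow> (case v of Inl a \<Rightarrow> cross a b | Inr b' \<Rightarrow> dB b b'))" for u v
  have cross_pos': "0 < cross a b" for a b using cross_pos[of a b] e by simp
  have "Metric_space Y dY"
  proof
    show "0 \<le> dY u v" for u v
      using cross_pos' by (auto simp: dY_def less_imp_le split: sum.splits)
    show "dY u v = dY v u" for u v
      by (auto simp: dY_def A.commute B.commute split: sum.splits)
    show "dY u v = 0 \<longleftrightarrow> u = v" if "u \<in> Y" "v \<in> Y" for u v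
      using that cross_pos' by (auto simp: dY_def Y_def less_le)
    show "dY u w \<le> dY u v + dY v w" if "u \<in> Y" "v \<in> Y" "w \<in> Y" for u v w
      using that AAB AAB' ABB ABB' ABA BAB A.triangle B.triangle
      by (auto simp: dY_def Y_def)
  qed
  moreover have "isometric_embedding A dA Y dY Inl" "isometric_embedding B dB Y dY Inr"
    by (auto simp: isometric_embedding_def Y_def dY_def)
  ultimately have "gh_distance A dA B dB \<le> hausdorff_distance dY (Inl ` A) (Inr ` B)"
    by (rule gh_distance_le)
  also have "\<dots> \<le> ennreal (2 * e)"
  proof -
    have close: "dY (Inl a) (Inr b) < 2 * e" if "(a, b) \<in> C" for a b
      using cross_le[OF that, of a b] CA[OF that] e by (simp add: dY_def)
    have "\<forall>a\<in>Inl ` A. \<exists>b\<in>Inr ` B. dY a b < 2 * e"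
      using close CA C(2) by (force simp: image_iff)
    moreover have "\<forall>b\<in>Inr ` B. \<exists>a\<in>Inl ` A. dY a b < 2 * e"
      using close CA C(3) by (force simp: image_iff)
    ultimately show ?thesis unfolding hausdorff_distance_def using e by (intro Inf_lower) auto
  qed
  finally show ?thesis .
qed

section \<open>Homothety-invariant compact families of pseudometrics\<close>

text \<open>
  The pullback of \<open>\<rho>\<close> under the homothety \<open>x \<mapsto> a + s x\<close>, normalised so that a translation-invariant
  homogeneous metric is fixed.  Pseudometrics are functions on pairs so that they carry
  the topology of pointwise convergence.
\<close>

definition rescaled :: "real \<Rightarrow> 'v::real_vector \<Rightarrow> ('v \<times> 'v \<Rightarrow> real) \<Rightarrow> 'v \<times> 'v \<Rightarrow> real" where
  "rescaled s a \<rho> = (\<lambda>(x, y). \<rho> (a + s *\<^sub>R x, a + s *\<^sub>R y) / s)"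

definition homothety_invariant :: "('v::real_vector \<times> 'v \<Rightarrow> real) set \<Rightarrow> bool" where
  "homothety_invariant C \<longleftrightarrow> (\<forall>\<rho>\<in>C. \<forall>s>0. \<forall>a. rescaled s a \<rho> \<in> C)"

lemma rescaled_mem:
  "homothety_invariant C \<Longrightarrow> \<rho> \<in> C \<Longrightarrow> 0 < s \<Longrightarrow> rescaled s a \<rho> \<in> C"
  by (auto simp: homothety_invariant_def)

lemma rescaled_apply: "rescaled s a \<rho> (x, y) = \<rho> (a + s *\<^sub>R x, a + s *\<^sub>R y) / s"
  by (simp add: rescaled_def)

lemma continuous_on_eval [continuous_intros]: "continuous_on A (\<lambda>\<rho> :: 'i \<Rightarrow> real. \<rho> p)"
  by (rule continuous_on_subset[OF continuous_on_product_coordinates]) simp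

text \<open>
  Take for \<open>m\<close> the maximum of \<open>\<rho> (0, v)\<close> over \<open>C\<close>.  Equality on all rays in direction \<open>v\<close> is obtained from the
  finite intersection property: finitely many base points, lengths and error bounds are treated at
  once by sliding along an extremal segment that is very long compared with the
  distances between the base points.
\<close>

lemma exists_maximal_in_direction:
  fixes C :: "('v::real_vector \<times> 'v \<Rightarrow> real) set" and v :: 'v
  assumes C: "compact C" "C \<noteq> {}" "homothety_invariant C"
    and zero: "\<And>\<rho> x. \<rho> \<in> C \<Longrightarrow> \<rho> (x, x) = 0"
    and tri: "\<And>\<rho> x y z. \<rho> \<in> C \<Longrightarrow> \<rho> (x, z) \<le> \<rho> (x, y) + \<rho> (y, z)"
    and bound: "\<And>\<rho> x y. \<rho> \<in> C \<Longrightarrow> \<rho> (x, y) \<le> q (y - x)"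
  obtains m \<rho> where "\<rho> \<in> C" "\<And>x t. 0 \<le> t \<Longrightarrow> \<rho> (x, x + t *\<^sub>R v) = t * m"
proof -
  obtain \<rho>0 where \<rho>0: "\<rho>0 \<in> C" "\<And>\<rho>. \<rho> \<in> C \<Longrightarrow> \<rho> (0, v) \<le> \<rho>0 (0, v)"
    using continuous_attains_sup[OF C(1,2) continuous_on_eval[of _ "(0, v)"]] by blast
  define m where "m = \<rho>0 (0, v)"
  have upper: "\<rho> (x, x + t *\<^sub>R v) \<le> t * m" if "\<rho> \<in> C" "0 \<le> t" for \<rho> x t
  proof (cases "t = 0")
    case False
    then have "rescaled t x \<rho> \<in> C" using that C(3) by (intro rescaled_mem) auto
    from \<rho>0(2)[OF this] show ?thesis
      using False that(2) by (simp add: rescaled_apply m_def field_simps)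
  qed (simp add: zero that)
  define f where "f = (\<lambda>(x, t, e). {\<rho> :: 'v \<times> 'v \<Rightarrow> real. t * m - e \<le> \<rho> (x, x + t *\<^sub>R v)})"
  define I where "I = {(x :: 'v, t :: real, e :: real). 0 \<le> t \<and> 0 < e}"
  have "C \<inter> (\<Inter>i\<in>I. f i) \<noteq> {}"
  proof (rule compact_imp_fip_image[OF C(1)])
    show "closed (f i)" for i
      unfolding f_def by (cases i) (auto intro!: closed_Collect_le continuous_intros)
  next
    fix J assume J: "finite J" "J \<subseteq> I"
    define P where "P = fst ` J"
    define T where "T = Max (insert 1 ((fst \<circ> snd) ` J))"
    define \<epsilon> where "\<epsilon> = Min (insert 1 ((snd \<circ> snd) ` J))"
    have finP: "finite P" using J by (simp add: P_def)
    have T: "T > 0" "\<And>x t e. (x, t, e) \<in> J \<Longrightarrow> t \<le> T"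
    proof -
      have "1 \<le> T" unfolding T_def by (rule Max_ge) (use J in auto)
      then show "T > 0" by simp
      show "t \<le> T" if "(x, t, e) \<in> J" for x t e
        unfolding T_def by (rule Max_ge) (use J that in \<open>force+\<close>)
    qed
    have \<epsilon>: "\<epsilon> > 0" "\<And>x t e. (x, t, e) \<in> J \<Longrightarrow> \<epsilon> \<le> e"
    proof -
      show "\<epsilon> > 0" unfolding \<epsilon>_def using J by (subst Min_gr_iff) (auto simp: I_def)
      show "\<epsilon> \<le> e" if "(x, t, e) \<in> J" for x t e
        unfolding \<epsilon>_def by (rule Min_le) (use J that in \<open>force+\<close>)
    qed
    \<comment> \<open>\<open>B\<close> bounds the total deficit of the parallel segments, however long they are; \<open>N\<close> pieces are
      then enough for one of them to have deficit below \<open>\<epsilon>\<close>.\<close>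
    define B where "B = (\<Sum>x\<in>P. q x + q (- x))"
    obtain N where N: "B < real N * \<epsilon>" "0 < N"
    proof -
      obtain N where "B / \<epsilon> < real N" using reals_Archimedean2 by blast
      then have "B < real (Suc N) * \<epsilon>" using \<epsilon>(1) by (simp add: field_simps)
      with that show ?thesis by blast
    qed
    define \<sigma> where "\<sigma> = rescaled (inverse (real N * T)) 0 \<rho>0"
    have \<sigma>C: "\<sigma> \<in> C" unfolding \<sigma>_def using N T \<rho>0 C(3) by (intro rescaled_mem) auto
    have \<sigma>: "\<sigma> (0, (real N * T) *\<^sub>R v) = real N * T * m"
    proof -
      have "inverse (real N * T) * (real N * T) = 1" using N T by (intro left_inverse) simp
      then show ?thesis by (simp add: \<sigma>_def rescaled_apply m_def divide_inverse)
    qed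
    define deficit where
      "deficit k x = T * m - \<sigma> (x + (real k * T) *\<^sub>R v, x + (real (Suc k) * T) *\<^sub>R v)" for k x
    have deficit_nonneg: "0 \<le> deficit k x" for k x
      using upper[OF \<sigma>C, of T "x + (real k * T) *\<^sub>R v"] T(1)
      by (simp add: deficit_def algebra_simps)
    have chain: "\<sigma> (x, x + (real k * T) *\<^sub>R v) \<le> (\<Sum>j<k. T * m - deficit j x)" for k x
    proof (induction k)
      case (Suc k)
      have "\<sigma> (x, x + (real (Suc k) * T) *\<^sub>R v) \<le> \<sigma> (x, x + (real k * T) *\<^sub>R v)
          + \<sigma> (x + (real k * T) *\<^sub>R v, x + (real (Suc k) * T) *\<^sub>R v)"
        by (rule tri[OF \<sigma>C])
      with Suc show ?case by (simp add: deficit_def)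
    qed (simp add: zero[OF \<sigma>C])
    have line: "(\<Sum>k<N. deficit k x) \<le> q x + q (- x)" for x
    proof -
      have "real N * T * m \<le> \<sigma> (0, x) + \<sigma> (x, (real N * T) *\<^sub>R v)"
        using tri[OF \<sigma>C, of 0 _ x] \<sigma> by metis
      also have "\<dots> \<le> \<sigma> (0, x) + \<sigma> (x, x + (real N * T) *\<^sub>R v)
          + \<sigma> (x + (real N * T) *\<^sub>R v, (real N * T) *\<^sub>R v)"
        using tri[OF \<sigma>C, of x _ "x + (real N * T) *\<^sub>R v"] by (simp add: algebra_simps)
      also have "\<dots> \<le> q x + (\<Sum>k<N. T * m - deficit k x) + q (- x)"
        using bound[OF \<sigma>C, of 0 x] chain[of x N]
          bound[OF \<sigma>C, of "x + (real N * T) *\<^sub>R v" "(real N * T) *\<^sub>R v"] by simp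
      finally show ?thesis by (simp add: sum_subtractf)
    qed
    have "\<exists>k<N. (\<Sum>x\<in>P. deficit k x) < \<epsilon>"
    proof (rule ccontr)
      assume "\<not> ?thesis"
      then have "\<epsilon> \<le> (\<Sum>x\<in>P. deficit k x)" if "k \<in> {..<N}" for k
        using that by (metis lessThan_iff not_less)
      from sum_bounded_below[of "{..<N}", OF this]
      have "real N * \<epsilon> \<le> (\<Sum>k<N. \<Sum>x\<in>P. deficit k x)" by simp
      also have "\<dots> = (\<Sum>x\<in>P. \<Sum>k<N. deficit k x)" by (rule sum.swap)
      also have "\<dots> \<le> B" unfolding B_def by (intro sum_mono line)
      finally show False using N by simp
    qed
    then obtain k where k: "(\<Sum>x\<in>P. deficit k x) < \<epsilon>" by blast
    \<comment> \<open>The good piece is moved to the origin.\<close>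
    define \<tau> where "\<tau> = rescaled 1 ((real k * T) *\<^sub>R v) \<sigma>"
    have \<tau>C: "\<tau> \<in> C" unfolding \<tau>_def using \<sigma>C C(3) by (intro rescaled_mem) auto
    have "\<tau> \<in> f (x, t, e)" if xte: "(x, t, e) \<in> J" for x t e
    proof -
      have "x \<in> P" using xte by (force simp: P_def)
      then have "deficit k x < \<epsilon>"
        using member_le_sum[of x P "deficit k"] deficit_nonneg finP k by force
      then have "T * m - \<epsilon> \<le> \<tau> (x, x + T *\<^sub>R v)"
        by (simp add: \<tau>_def rescaled_apply deficit_def algebra_simps)
      also have "\<dots> \<le> \<tau> (x, x + t *\<^sub>R v) + \<tau> (x + t *\<^sub>R v, x + T *\<^sub>R v)"
        by (rule tri[OF \<tau>C])
      also have "\<tau> (x + t *\<^sub>R v, x + T *\<^sub>R v) \<le> (T - t) * m"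
        using upper[OF \<tau>C, of "T - t" "x + t *\<^sub>R v"] T(2)[OF xte] by (simp add: algebra_simps)
      finally show ?thesis using \<epsilon>(2)[OF xte] by (simp add: f_def algebra_simps)
    qed
    then have "\<tau> \<in> C \<inter> (\<Inter>i\<in>J. f i)" using \<tau>C by auto
    then show "C \<inter> (\<Inter>i\<in>J. f i) \<noteq> {}" by blast
  qed
  then obtain \<rho> where \<rho>: "\<rho> \<in> C" "\<And>i. i \<in> I \<Longrightarrow> \<rho> \<in> f i" by blast
  have "\<rho> (x, x + t *\<^sub>R v) = t * m" if "0 \<le> t" for x t
  proof (rule antisym)
    have "t * m \<le> \<rho> (x, x + t *\<^sub>R v) + e" if "0 < e" for e
      using \<rho>(2)[of "(x, t, e)"] \<open>0 \<le> t\<close> that by (simp add: I_def f_def)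
    then show "t * m \<le> \<rho> (x, x + t *\<^sub>R v)" by (rule field_le_epsilon)
  qed (rule upper[OF \<rho>(1) that])
  with \<rho>(1) that show ?thesis by blast
qed

text \<open>
  Zorn's lemma, applied to the complements; compactness keeps the intersection of a chain nonempty.
\<close>

lemma exists_minimal_invariant:
  fixes C :: "('v::real_vector \<times> 'v \<Rightarrow> real) set"
  assumes C: "compact C" "closed C" "C \<noteq> {}" "homothety_invariant C"
  obtains M where "M \<subseteq> C" "closed M" "M \<noteq> {}" "homothety_invariant M"
    "\<And>D. D \<subseteq> M \<Longrightarrow> closed D \<Longrightarrow> D \<noteq> {} \<Longrightarrow> homothety_invariant D \<Longrightarrow> D = M"
proof -
  define \<A> where "\<A> = {U. \<exists>D. U = - D \<and> D \<subseteq> C \<and> closed D \<and> D \<noteq> {} \<and> homothety_invariant D}"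
  have "\<exists>U\<in>\<A>. \<forall>X\<in>c. X \<subseteq> U" if c: "c \<in> chains \<A>" for c
  proof (cases "c = {}")
    case True
    then show ?thesis using C unfolding \<A>_def by blast
  next
    case False
    define F where "F = uminus ` c"
    have FA: "D \<subseteq> C \<and> closed D \<and> D \<noteq> {} \<and> homothety_invariant D" if "D \<in> F" for D
      using chainsD2[OF c] that unfolding \<A>_def F_def by auto
    have "C \<inter> \<Inter>F \<noteq> {}"
    proof (rule compact_imp_fip[OF C(1)])
      show "closed T" if "T \<in> F" for T using FA that by blast
    next
      fix F' assume F': "finite F'" "F' \<subseteq> F"
      show "C \<inter> \<Inter>F' \<noteq> {}"
      proof (cases "F' = {}")
        case False
        have "D \<subseteq> E \<or> E \<subseteq> D" if "D \<in> F'" "E \<in> F'" for D E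
          using F' that chainsD[OF c] unfolding F_def by blast
        then have "subset.chain F' F'" unfolding subset_chain_def by blast
        then have "\<Inter>F' \<in> F'" using Inter_in_chain[OF F'(1) False] by blast
        then show ?thesis using FA F'(2) by blast
      qed (use C in simp)
    qed
    moreover have "homothety_invariant (\<Inter>F)"
      using FA unfolding homothety_invariant_def by blast
    moreover have "\<Inter>F \<subseteq> C" using FA False unfolding F_def by blast
    moreover have "closed (\<Inter>F)" using FA by (intro closed_Inter) blast
    ultimately have "- \<Inter>F \<in> \<A>" unfolding \<A>_def by blast
    moreover have "\<forall>X\<in>c. X \<subseteq> - \<Inter>F" unfolding F_def by blast
    ultimately show ?thesis by blast
  qed
  then obtain U where U: "U \<in> \<A>" "\<forall>X\<in>\<A>. U \<subseteq> X \<longrightarrow> X = U" using Zorn_Lemma2[of \<A>] by blast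
  then obtain M where M: "U = - M" "M \<subseteq> C" "closed M" "M \<noteq> {}" "homothety_invariant M"
    unfolding \<A>_def by blast
  show ?thesis
  proof (rule that[OF M(2-5)])
    fix D assume D: "D \<subseteq> M" "closed D" "D \<noteq> {}" "homothety_invariant D"
    then have "- D \<in> \<A>" using M(2) unfolding \<A>_def by blast
    then have "- D = U" using U(2) M(1) D(1) by blast
    then show "D = M" using M(1) by blast
  qed
qed

text \<open>
  In a minimal closed invariant set, the elements that are extremal in direction \<open>v\<close> form a nonempty
  closed invariant subset, hence everything; and this holds for all \<open>v\<close> simultaneously.
\<close>

lemma exists_homogeneous_element:
  fixes C :: "('v::real_vector \<times> 'v \<Rightarrow> real) set"
  assumes C: "compact C" "closed C" "C \<noteq> {}" "homothety_invariant C"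
    and zero: "\<And>\<rho> x. \<rho> \<in> C \<Longrightarrow> \<rho> (x, x) = 0"
    and tri: "\<And>\<rho> x y z. \<rho> \<in> C \<Longrightarrow> \<rho> (x, z) \<le> \<rho> (x, y) + \<rho> (y, z)"
    and bound: "\<And>\<rho> x y. \<rho> \<in> C \<Longrightarrow> \<rho> (x, y) \<le> q (y - x)"
  obtains \<rho> where "\<rho> \<in> C" "\<And>x v t. 0 \<le> t \<Longrightarrow> \<rho> (x, x + t *\<^sub>R v) = t * \<rho> (0, v)"
proof -
  obtain M where M: "M \<subseteq> C" "closed M" "M \<noteq> {}" "homothety_invariant M"
    and min: "\<And>D. D \<subseteq> M \<Longrightarrow> closed D \<Longrightarrow> D \<noteq> {} \<Longrightarrow> homothety_invariant D \<Longrightarrow> D = M"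
    using exists_minimal_invariant[OF C] by blast
  have "compact (C \<inter> M)" using C(1) M(2) by (rule compact_Int_closed)
  then have Mc: "compact M" using M(1) by (simp add: Int_absorb1)
  have homog: "\<rho> (x, x + t *\<^sub>R v) = t * \<rho> (0, v)" if \<rho>: "\<rho> \<in> M" and t: "0 \<le> t" for \<rho> x v t
  proof -
    obtain m \<sigma> where m: "\<sigma> \<in> M" "\<And>x t. 0 \<le> t \<Longrightarrow> \<sigma> (x, x + t *\<^sub>R v) = t * m"
      using exists_maximal_in_direction[OF Mc M(3,4), of q v] zero tri bound M(1)
      by (metis subsetD)
    define D where "D = M \<inter> (\<Inter>x. \<Inter>t\<in>{0..}. {\<rho>. \<rho> (x, x + t *\<^sub>R v) = t * m})"
    have "D = M"
    proof (rule min)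
      show "D \<subseteq> M" by (auto simp: D_def)
      show "closed D" unfolding D_def
        by (intro closed_Int closed_INT M(2) ballI closed_Collect_eq continuous_intros)
      show "D \<noteq> {}" using m by (auto simp: D_def)
      show "homothety_invariant D"
        unfolding homothety_invariant_def
      proof (intro ballI allI impI)
        fix \<rho> s and a :: 'v assume \<rho>: "\<rho> \<in> D" and s: "(0::real) < s"
        have "rescaled s a \<rho> (x, x + t *\<^sub>R v) = t * m" if "0 \<le> t" for x t
        proof -
          have "\<rho> (a + s *\<^sub>R x, a + s *\<^sub>R x + (s * t) *\<^sub>R v) = s * t * m"
            using \<rho> s that by (auto simp: D_def)
          then show ?thesis using s by (simp add: rescaled_apply algebra_simps)
        qed
        moreover have "rescaled s a \<rho> \<in> M" using \<rho> s M(4) by (auto simp: D_def intro: rescaled_mem)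
        ultimately show "rescaled s a \<rho> \<in> D" by (auto simp: D_def)
      qed
    qed
    with \<rho> have *: "\<rho> (y, y + r *\<^sub>R v) = r * m" if "0 \<le> r" for y r
      using that by (auto simp: D_def)
    show ?thesis using *[OF t] *[of 1 0] by simp
  qed
  from M(3) obtain \<rho> where "\<rho> \<in> M" by blast
  with homog M(1) that show ?thesis by blast
qed

section \<open>Homothetic copies of finite sets in sets of positive measure\<close>

lemma distr_PiM_lborel_translation:
  fixes c :: "'i \<Rightarrow> real"
  assumes "finite I"
  shows "distr (\<Pi>\<^sub>M i\<in>I. lborel) (\<Pi>\<^sub>M i\<in>I. lborel) (\<lambda>x. \<lambda>i\<in>I. x i + c i) = (\<Pi>\<^sub>M i\<in>I. lborel)"
    (is "distr ?P ?P ?T = ?P")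
proof -
  interpret product_sigma_finite "\<lambda>_ :: 'i. lborel :: real measure" by standard
  have T: "?T \<in> measurable ?P ?P"
    by (intro measurable_restrict borel_measurable_add) simp_all
  show ?thesis
  proof (rule PiM_eqI)
    fix A :: "'i \<Rightarrow> real set" assume A: "\<And>i. i \<in> I \<Longrightarrow> A i \<in> sets lborel"
    have shift: "emeasure lborel ((+) t -` S) = emeasure lborel S" if "S \<in> sets lborel"
      for t :: real and S
      using that emeasure_distr[of "(+) t" lborel borel S] by (simp add: lborel_distr_plus)
    have meas: "(+) (c i) -` A i \<in> sets lborel" if "i \<in> I" for i
      using measurable_sets[of "(+) (c i)" borel borel "A i"] A[OF that] by simp
    have "emeasure (distr ?P ?P ?T) (Pi\<^sub>E I A) = emeasure ?P (?T -` Pi\<^sub>E I A \<inter> space ?P)"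
      using T A assms by (intro emeasure_distr) (auto intro!: sets_PiM_I_finite)
    also have "?T -` Pi\<^sub>E I A \<inter> space ?P = Pi\<^sub>E I (\<lambda>i. (+) (c i) -` A i)"
      by (auto simp: space_PiM PiE_def Pi_def add.commute)
    also have "emeasure ?P \<dots> = (\<Prod>i\<in>I. emeasure lborel ((+) (c i) -` A i))"
      using assms meas by (intro emeasure_PiM) auto
    also have "\<dots> = (\<Prod>i\<in>I. emeasure lborel (A i))"
      using A by (intro prod.cong refl shift) auto
    finally show "emeasure (distr ?P ?P ?T) (Pi\<^sub>E I A) = (\<Prod>i\<in>I. emeasure lborel (A i))" .
  qed (use assms in auto)
qed

text \<open>
  If \<open>r\<close> is small, the set of all \<open>x\<close> with \<open>x + r a \<in> K\<close> is a translate of \<open>K\<close> inside a neighbourhood of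
  \<open>K\<close> whose measure exceeds that of \<open>K\<close> by less than the fraction \<open>1 / (card F + 1)\<close>.  The complements of
  these translates, for \<open>a \<in> F\<close>, are too small to cover the neighbourhood.
\<close>

lemma positive_measure_contains_homothetic_copy:
  fixes K F :: "(nat \<Rightarrow> real) set"
  assumes K: "compactin (product_topology (\<lambda>_. euclideanreal) {..<n}) K"
    and pos: "0 < emeasure (\<Pi>\<^sub>M i\<in>{..<n}. lborel) K" and F: "finite F"
  obtains x r where "0 < r" "\<And>a. a \<in> F \<Longrightarrow> (\<lambda>i\<in>{..<n}. x i + r * a i) \<in> K"
proof -
  define P where "P = (\<Pi>\<^sub>M i\<in>{..<n}. lborel :: real measure)"
  define D where "D x k = (\<Sum>i<n. \<bar>x i - k i\<bar>)" for x k :: "nat \<Rightarrow> real"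
  define U where "U e = {x \<in> space P. \<exists>k\<in>K. D x k < e}" for e
  interpret product_sigma_finite "\<lambda>_ :: nat. lborel :: real measure" by standard
  have spP: "space P = extensional {..<n}" by (auto simp: P_def space_PiM PiE_def)
  have KP: "K \<in> sets P" using pos unfolding P_def by (intro emeasure_neq_0_sets) auto
  have K_sub: "K \<subseteq> space P" using KP by (rule sets.sets_into_space)
  have K_ne: "K \<noteq> {}" using pos by auto
  have U_meas: "U e \<in> sets P" for e
  proof -
    \<comment> \<open>Extending points by zero makes \<open>U e\<close> the preimage of an open set of the function type, where
      open sets are measurable.\<close>
    define g where "g x = (\<lambda>i. if i < n then x i else 0)" for x :: "nat \<Rightarrow> real"
    have "g \<in> measurable P borel"
    proof (rule measurable_coordinatewise_then_product)
      fix i show "(\<lambda>x. g x i) \<in> borel_measurable P"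
      proof (cases "i < n")
        case True
        then have "(\<lambda>x. x i) \<in> measurable P lborel"
          unfolding P_def by (intro measurable_component_singleton) simp
        with True show ?thesis by (simp add: g_def)
      qed (simp add: g_def)
    qed
    moreover have "open (\<Union>k\<in>K. {y. D y k < e})"
      unfolding D_def by (intro open_UN ballI open_Collect_less continuous_intros)
    ultimately have "g -` (\<Union>k\<in>K. {y. D y k < e}) \<inter> space P \<in> sets P" by measurable
    also have "g -` (\<Union>k\<in>K. {y. D y k < e}) \<inter> space P = U e"
      by (auto simp: U_def D_def g_def)
    finally show ?thesis .
  qed
  have K_U: "K \<subseteq> U e" if "0 < e" for e
    using K_sub that by (force simp: U_def D_def)
  have U_mono: "U e \<subseteq> U e'" if "e \<le> e'" for e e' using that by (force simp: U_def)
  have U_fin: "emeasure P (U 1) < \<infinity>"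
  proof -
    have "\<exists>b. \<forall>k\<in>K. \<bar>k i\<bar> \<le> b" if "i < n" for i
    proof -
      have "compactin euclideanreal ((\<lambda>k. k i) ` K)"
        using K by (rule image_compactin) (use that continuous_map_product_projection[of i "{..<n}" "\<lambda>_. euclideanreal"] in simp)
      then have "bounded ((\<lambda>k. k i) ` K)" by (simp add: compact_imp_bounded)
      then show ?thesis by (auto simp: bounded_iff)
    qed
    then obtain b where b: "\<And>i k. i < n \<Longrightarrow> k \<in> K \<Longrightarrow> \<bar>k i\<bar> \<le> b i" by metis
    have "U 1 \<subseteq> Pi\<^sub>E {..<n} (\<lambda>i. {- b i - 1..b i + 1})"
    proof
      fix x assume "x \<in> U 1"
      then obtain k where k: "x \<in> space P" "k \<in> K" "D x k < 1" by (auto simp: U_def)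
      have abs: "\<bar>x i\<bar> \<le> b i + 1" if "i < n" for i
        using b[OF that k(2)] k(3) member_le_sum[of i "{..<n}" "\<lambda>i. \<bar>x i - k i\<bar>"] that
        unfolding D_def by simp
      have "x i \<in> {- b i - 1..b i + 1}" if "i < n" for i
        using abs[OF that] by (simp add: abs_le_iff)
      then show "x \<in> Pi\<^sub>E {..<n} (\<lambda>i. {- b i - 1..b i + 1})"
        using k(1) by (auto simp: spP PiE_def Pi_def)
    qed
    then have "emeasure P (U 1) \<le> emeasure P (Pi\<^sub>E {..<n} (\<lambda>i. {- b i - 1..b i + 1}))"
      unfolding P_def by (intro emeasure_mono sets_PiM_I_finite) auto
    also have "\<dots> = (\<Prod>i<n. emeasure lborel {- b i - 1..b i + 1})"
      unfolding P_def by (intro emeasure_PiM) auto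
    also have "\<dots> < \<infinity>" by (auto simp: less_top[symmetric] ennreal_prod_eq_top emeasure_lborel_Icc_eq)
    finally show ?thesis .
  qed
  define u where "u j = U (inverse (real (Suc j)))" for j
  have u_fin: "emeasure P (u j) < \<infinity>" for j
    using emeasure_mono[of "u j" "U 1" P] U_fin U_meas U_mono[of "inverse (real (Suc j))" 1]
    by (simp add: u_def inverse_eq_divide)
  have "(\<Inter>j. u j) = K"
  proof
    show "K \<subseteq> (\<Inter>j. u j)" unfolding u_def by (intro INT_greatest K_U) simp
    show "(\<Inter>j. u j) \<subseteq> K"
    proof
      fix x assume x: "x \<in> (\<Inter>j. u j)"
      have "compactin euclideanreal (D x ` K)"
        using K unfolding D_def
        by (rule image_compactin) (intro continuous_intros, auto)
      then have "compact (D x ` K)" by simp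
      then obtain k where k: "k \<in> K" "\<And>k'. k' \<in> K \<Longrightarrow> D x k \<le> D x k'"
        using compact_attains_inf[of "D x ` K"] K_ne by auto
      have "D x k < inverse (real (Suc j))" for j
        using x k(2) unfolding u_def U_def by (blast intro: le_less_trans)
      then have "D x k \<le> 0" using reals_Archimedean[of "D x k"] by (meson not_less less_asym)
      then have "D x k = 0" by (simp add: D_def sum_nonneg antisym)
      then have "\<forall>i<n. x i = k i" by (simp add: D_def sum_nonneg_eq_0_iff)
      moreover have "x \<in> extensional {..<n}" "k \<in> extensional {..<n}"
        using x k(1) K_sub by (auto simp: u_def U_def spP)
      ultimately have "x = k" by (intro extensionalityI) auto
      with k(1) show "x \<in> K" by simp
    qed
  qed
  moreover have "(\<lambda>j. measure P (u j)) \<longlonglongrightarrow> measure P (\<Inter>j. u j)"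
  proof (rule Lim_measure_decseq)
    show "range u \<subseteq> sets P" using U_meas by (auto simp: u_def)
    show "decseq u" unfolding u_def by (intro decseq_SucI U_mono) (simp add: field_simps)
    show "emeasure P (u i) \<noteq> \<infinity>" for i using u_fin[of i] by simp
  qed
  ultimately have lim: "(\<lambda>j. measure P (u j)) \<longlonglongrightarrow> measure P K" by simp
  have fm: "u j \<in> fmeasurable P" for j
    using u_fin U_meas by (auto simp: u_def fmeasurable_def)
  have Ku: "K \<subseteq> u j" for j unfolding u_def by (rule K_U) simp
  have Kfm: "K \<in> fmeasurable P" using fmeasurableI2[OF fm Ku KP] .
  have muK: "0 < measure P K"
    using pos Kfm unfolding P_def[symmetric] by (simp add: emeasure_eq_measure2)
  have "eventually (\<lambda>j. measure P (u j) < measure P K + measure P K / (real (card F) + 1)) sequentially"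
    using lim by (rule order_tendstoD) (use muK in simp)
  then obtain j where j: "measure P (u j) < measure P K + measure P K / (real (card F) + 1)"
    unfolding eventually_sequentially by blast
  define r where "r = inverse (real (Suc j)) / (1 + (\<Sum>a\<in>F. \<Sum>i<n. \<bar>a i\<bar>))"
  have r: "0 < r" unfolding r_def by (intro divide_pos_pos add_pos_nonneg sum_nonneg) auto
  have r_small: "(\<Sum>i<n. \<bar>r * a i\<bar>) < inverse (real (Suc j))" if "a \<in> F" for a
  proof -
    have nn: "0 \<le> (\<Sum>a\<in>F. \<Sum>i<n. \<bar>a i\<bar>)" by (intro sum_nonneg) auto
    have "(\<Sum>i<n. \<bar>a i\<bar>) \<le> (\<Sum>a\<in>F. \<Sum>i<n. \<bar>a i\<bar>)"
      using F that by (intro member_le_sum) (auto intro: sum_nonneg)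
    then have "r * (\<Sum>i<n. \<bar>a i\<bar>) < r * (1 + (\<Sum>a\<in>F. \<Sum>i<n. \<bar>a i\<bar>))"
      using r by simp
    also have "\<dots> = inverse (real (Suc j))" unfolding r_def using nn by simp
    finally show ?thesis using r by (simp add: abs_mult sum_distrib_left)
  qed
  define T where "T a x = (\<lambda>i\<in>{..<n}. x i + r * a i)" for a x :: "nat \<Rightarrow> real"
  define K' where "K' a = T a -` K \<inter> space P" for a
  have T_meas: "T a \<in> measurable P P" for a
    unfolding T_def P_def by (intro measurable_restrict borel_measurable_add) simp_all
  have K'_meas: "K' a \<in> sets P" for a unfolding K'_def using T_meas KP by (rule measurable_sets)
  have K'_measure: "measure P (K' a) = measure P K" for a
  proof -
    have "distr P P (T a) = P"
      unfolding T_def P_def by (rule distr_PiM_lborel_translation) simp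
    then show ?thesis unfolding K'_def using measure_distr[OF T_meas KP, of a] by simp
  qed
  have K'_sub: "K' a \<subseteq> u j" if "a \<in> F" for a
  proof
    fix x assume x: "x \<in> K' a"
    have "D x (T a x) = (\<Sum>i<n. \<bar>r * a i\<bar>)" by (simp add: D_def T_def)
    with r_small[OF that] x show "x \<in> u j"
      by (auto simp: u_def U_def K'_def intro!: bexI[of _ "T a x"])
  qed
  have diff_fm: "u j - K' a \<in> fmeasurable P" for a
    by (rule fmeasurableI2[OF fm[of j]]) (use fm K'_meas in auto)
  have "\<exists>x\<in>u j. \<forall>a\<in>F. x \<in> K' a"
  proof (rule ccontr)
    assume "\<not> ?thesis"
    then have "u j \<subseteq> (\<Union>a\<in>F. u j - K' a)" by blast
    then have "measure P (u j) \<le> measure P (\<Union>a\<in>F. u j - K' a)"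
      using F fm diff_fm by (intro measure_mono_fmeasurable fmeasurable.finite_UN) auto
    also have "\<dots> \<le> (\<Sum>a\<in>F. measure P (u j - K' a))"
      using fm K'_meas F by (intro measure_UNION_le) auto
    also have "\<dots> = (\<Sum>a\<in>F. measure P (u j) - measure P K)"
      using fm K'_meas K'_sub K'_measure u_fin
      by (intro sum.cong refl) (simp add: measure_Diff less_top[symmetric] fmeasurableD)
    also have "\<dots> = real (card F) * (measure P (u j) - measure P K)" by simp
    also have "\<dots> \<le> real (card F) * (measure P K / (real (card F) + 1))"
      using j by (intro mult_left_mono) auto
    also have "\<dots> < measure P K" using muK by (simp add: field_simps)
    also have "\<dots> \<le> measure P (u j)" using fm KP Ku by (intro measure_mono_fmeasurable) auto
    finally show False by simp
  qed
  then obtain x where "\<And>a. a \<in> F \<Longrightarrow> T a x \<in> K" by (auto simp: K'_def)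
  with r that show ?thesis unfolding T_def by blast
qed

section \<open>Norms that are visible at large scales\<close>

lemma compact_closed_box:
  fixes b :: "'i \<Rightarrow> real set"
  assumes "\<And>p. compact (b p)"
  shows "compact {\<rho>. \<forall>p. \<rho> p \<in> b p}" "closed {\<rho>. \<forall>p. \<rho> p \<in> b p}"
proof -
  have "compactin (product_topology (\<lambda>_. euclideanreal) UNIV) (Pi\<^sub>E UNIV b)"
    using assms by (simp add: compactin_PiE)
  moreover have "Pi\<^sub>E UNIV b = {\<rho>. \<forall>p. \<rho> p \<in> b p}" by (auto simp: PiE_def Pi_def)
  ultimately show "compact {\<rho>. \<forall>p. \<rho> p \<in> b p}" by (simp add: euclidean_product_topology)
  have "closed ((\<lambda>\<rho>. \<rho> p) -` b p)" for p
    using continuous_on_eval[of UNIV p] compact_imp_closed[OF assms] closed_vimage by blast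
  then have "closed (\<Inter>p. (\<lambda>\<rho>. \<rho> p) -` b p)" by (intro closed_INT) auto
  also have "(\<Inter>p. (\<lambda>\<rho>. \<rho> p) -` b p) = {\<rho>. \<forall>p. \<rho> p \<in> b p}" by auto
  finally show "closed {\<rho>. \<forall>p. \<rho> p \<in> b p}" .
qed

text \<open>
  The finite form of being an asymptotic subset: the restriction of \<open>\<rho>\<close> to \<open>F\<close> is visible in \<open>X\<close>
  at arbitrarily large scales \<open>R\<close>.  No limit space is involved, and for finite \<open>F\<close> the condition
  is closed in \<open>\<rho>\<close>.
\<close>

definition approximable_on ::
    "'a set \<Rightarrow> ('a \<Rightarrow> 'a \<Rightarrow> real) \<Rightarrow> 'v set \<Rightarrow> ('v \<times> 'v \<Rightarrow> real) \<Rightarrow> bool" where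
  "approximable_on X d F \<rho> \<longleftrightarrow>
     (\<forall>\<epsilon>>0. \<forall>R0. \<exists>R f. R0 \<le> R \<and> 0 < R \<and> f ` F \<subseteq> X \<and>
        (\<forall>x\<in>F. \<forall>y\<in>F. \<bar>inverse R * d (f x) (f y) - \<rho> (x, y)\<bar> < \<epsilon>))"

lemma abs_divide_less:
  fixes x :: real
  assumes "\<bar>x\<bar> < e * s" "0 < s"
  shows "\<bar>x / s\<bar> < e"
  using assms by (simp add: abs_divide pos_divide_less_eq)

lemma approximable_onD:
  "approximable_on X d F \<rho> \<Longrightarrow> 0 < \<epsilon> \<Longrightarrow> \<exists>R f. R0 \<le> R \<and> 0 < R \<and> f ` F \<subseteq> X \<and>
     (\<forall>x\<in>F. \<forall>y\<in>F. \<bar>inverse R * d (f x) (f y) - \<rho> (x, y)\<bar> < \<epsilon>)"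
  unfolding approximable_on_def by blast

lemma approximable_on_subset:
  assumes "approximable_on X d G \<rho>" "F \<subseteq> G"
  shows "approximable_on X d F \<rho>"
  unfolding approximable_on_def
proof (intro allI impI)
  fix \<epsilon> R0 :: real assume "0 < \<epsilon>"
  from approximable_onD[OF assms(1) this, of R0]
  obtain R f where "R0 \<le> R" "0 < R" "f ` G \<subseteq> X"
    "\<forall>x\<in>G. \<forall>y\<in>G. \<bar>inverse R * d (f x) (f y) - \<rho> (x, y)\<bar> < \<epsilon>" by (elim exE conjE)
  with assms(2) show "\<exists>R f. R0 \<le> R \<and> 0 < R \<and> f ` F \<subseteq> X \<and>
      (\<forall>x\<in>F. \<forall>y\<in>F. \<bar>inverse R * d (f x) (f y) - \<rho> (x, y)\<bar> < \<epsilon>)"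
    by (intro exI[of _ R] exI[of _ f]) (auto simp: subset_iff)
qed

lemma closed_approximable_on:
  fixes F :: "'v set"
  assumes F: "finite F"
  shows "closed {\<rho>. approximable_on X d F \<rho>}"
proof -
  have "\<exists>T. open T \<and> \<rho> \<in> T \<and> T \<subseteq> - {\<rho>. approximable_on X d F \<rho>}"
    if "\<rho> \<in> - {\<rho>. approximable_on X d F \<rho>}" for \<rho>
  proof -
    have "\<not> approximable_on X d F \<rho>" using that by simp
    then obtain \<epsilon> R0 where \<epsilon>: "0 < \<epsilon>" and bad: "\<And>R f. R0 \<le> R \<Longrightarrow> 0 < R \<Longrightarrow> f ` F \<subseteq> X \<Longrightarrow>
        \<not> (\<forall>x\<in>F. \<forall>y\<in>F. \<bar>inverse R * d (f x) (f y) - \<rho> (x, y)\<bar> < \<epsilon>)"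
      unfolding approximable_on_def by blast
    define T where "T = (\<Inter>p\<in>F \<times> F. {\<sigma>. \<bar>\<sigma> p - \<rho> p\<bar> < \<epsilon> / 2})"
    have "open T" unfolding T_def
      using F by (intro open_INT ballI open_Collect_less continuous_intros) auto
    moreover have "\<rho> \<in> T" using \<epsilon> by (simp add: T_def)
    moreover have "\<not> approximable_on X d F \<sigma>" if \<sigma>: "\<sigma> \<in> T" for \<sigma>
    proof
      assume "approximable_on X d F \<sigma>"
      then obtain R f where R: "R0 \<le> R" "0 < R" "f ` F \<subseteq> X"
        and f: "\<And>x y. x \<in> F \<Longrightarrow> y \<in> F \<Longrightarrow> \<bar>inverse R * d (f x) (f y) - \<sigma> (x, y)\<bar> < \<epsilon> / 2"
        using approximable_onD[OF _ half_gt_zero[OF \<epsilon>], of X d F \<sigma> R0] by blast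
      have "\<bar>inverse R * d (f x) (f y) - \<rho> (x, y)\<bar> < \<epsilon>" if xy: "x \<in> F" "y \<in> F" for x y
      proof -
        have "\<bar>\<sigma> (x, y) - \<rho> (x, y)\<bar> < \<epsilon> / 2" using \<sigma> xy by (auto simp: T_def)
        with f[OF xy] show ?thesis by linarith
      qed
      with bad[OF R] show False by blast
    qed
    ultimately show ?thesis by blast
  qed
  then have "open (- {\<rho>. approximable_on X d F \<rho>})" by (subst open_subopen) blast
  then show ?thesis by (simp add: closed_def)
qed

lemma approximable_on_rescaled:
  assumes \<rho>: "approximable_on X d ((\<lambda>x. a + s *\<^sub>R x) ` F) \<rho>" and s: "0 < s"
  shows "approximable_on X d F (rescaled s a \<rho>)"
  unfolding approximable_on_def
proof (intro allI impI)
  fix \<epsilon> R0 :: real assume "0 < \<epsilon>"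
  define h where "h x = a + s *\<^sub>R x" for x
  obtain R f where R: "R0 / s \<le> R" "0 < R" "f ` h ` F \<subseteq> X"
    and f: "\<And>x y. x \<in> h ` F \<Longrightarrow> y \<in> h ` F \<Longrightarrow> \<bar>inverse R * d (f x) (f y) - \<rho> (x, y)\<bar> < \<epsilon> * s"
    using approximable_onD[OF \<rho>[folded h_def] mult_pos_pos[OF \<open>0 < \<epsilon>\<close> s], of "R0 / s"]
    by (elim exE conjE) blast
  have *: "\<bar>inverse (s * R) * d (f (h x)) (f (h y)) - rescaled s a \<rho> (x, y)\<bar> < \<epsilon>"
    if "x \<in> F" "y \<in> F" for x y
  proof -
    have eq: "inverse (s * R) * d (f (h x)) (f (h y)) - rescaled s a \<rho> (x, y)
        = (inverse R * d (f (h x)) (f (h y)) - \<rho> (h x, h y)) / s"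
      using s by (simp add: rescaled_apply h_def field_simps)
    show ?thesis unfolding eq using s f that by (intro abs_divide_less) auto
  qed
  show "\<exists>R f. R0 \<le> R \<and> 0 < R \<and> f ` F \<subseteq> X \<and>
      (\<forall>x\<in>F. \<forall>y\<in>F. \<bar>inverse R * d (f x) (f y) - rescaled s a \<rho> (x, y)\<bar> < \<epsilon>)"
  proof (intro exI conjI ballI)
    show "R0 \<le> s * R" "0 < s * R" using R s by (simp_all add: field_simps)
    show "(\<lambda>x. f (h x)) ` F \<subseteq> X" using R(3) by (simp add: image_image)
  qed (rule *)
qed

text \<open>
  A fixed factor \<open>r\<close> can be absorbed into the scale, so metrics obtained by blowing up an
  asymptotic subset are visible at large scales as well.
\<close>

lemma asymptotic_subset_approximable_on:
  assumes Z: "asymptotic_subset X d Z dZ" and r: "0 < r" and g: "g ` F \<subseteq> Z"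
    and \<rho>: "\<And>x y. x \<in> F \<Longrightarrow> y \<in> F \<Longrightarrow> \<rho> (x, y) = dZ (g x) (g y) / r"
  shows "approximable_on X d F \<rho>"
  unfolding approximable_on_def
proof (intro allI impI)
  fix \<epsilon> R0 :: real assume \<epsilon>: "0 < \<epsilon>"
  obtain S c where S: "\<And>j. S j \<subseteq> X" "\<And>j. 0 < c j" "filterlim c at_top sequentially"
    and lim: "(\<lambda>j. gh_distance (S j) (\<lambda>x y. inverse (c j) * d x y) Z dZ) \<longlonglongrightarrow> 0"
    using Z unfolding asymptotic_subset_def gh_converges_def by blast
  have "eventually (\<lambda>j. gh_distance (S j) (\<lambda>x y. inverse (c j) * d x y) Z dZ
      < ennreal (\<epsilon> * r / 2)) sequentially"
    using lim by (rule order_tendstoD) (use \<epsilon> r in simp)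
  moreover have "eventually (\<lambda>j. R0 / r \<le> c j) sequentially"
    using S(3) by (simp add: filterlim_at_top)
  ultimately have "eventually (\<lambda>j. gh_distance (S j) (\<lambda>x y. inverse (c j) * d x y) Z dZ
      < ennreal (\<epsilon> * r / 2) \<and> R0 / r \<le> c j) sequentially" by (rule eventually_conj)
  then obtain j where j: "gh_distance (S j) (\<lambda>x y. inverse (c j) * d x y) Z dZ < ennreal (\<epsilon> * r / 2)"
    "R0 / r \<le> c j"
    unfolding eventually_sequentially by blast
  from j(1) obtain p where p: "p \<in> Z \<rightarrow> S j"
    "\<And>z w. z \<in> Z \<Longrightarrow> w \<in> Z \<Longrightarrow> \<bar>inverse (c j) * d (p z) (p w) - dZ z w\<bar> < 2 * (\<epsilon> * r / 2)"
    by (rule gh_distance_less_imp_almost_isometry) blast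
  have *: "\<bar>inverse (c j * r) * d (p (g x)) (p (g y)) - \<rho> (x, y)\<bar> < \<epsilon>" if xy: "x \<in> F" "y \<in> F" for x y
  proof -
    have eq: "inverse (c j * r) * d (p (g x)) (p (g y)) - \<rho> (x, y)
        = (inverse (c j) * d (p (g x)) (p (g y)) - dZ (g x) (g y)) / r"
      using r by (simp add: \<rho>[OF xy] field_simps)
    have "\<bar>inverse (c j) * d (p (g x)) (p (g y)) - dZ (g x) (g y)\<bar> < \<epsilon> * r"
      using p(2)[of "g x" "g y"] g xy by auto
    then show ?thesis unfolding eq using r by (rule abs_divide_less)
  qed
  show "\<exists>R f. R0 \<le> R \<and> 0 < R \<and> f ` F \<subseteq> X \<and>
      (\<forall>x\<in>F. \<forall>y\<in>F. \<bar>inverse R * d (f x) (f y) - \<rho> (x, y)\<bar> < \<epsilon>)"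
  proof (intro exI conjI ballI)
    show "R0 \<le> c j * r" "0 < c j * r" using j(2) r S(2) by (simp_all add: field_simps)
    show "(\<lambda>x. p (g x)) ` F \<subseteq> X" using p(1) g S(1) by blast
  qed (rule *)
qed

text \<open>
  The function \<open>q\<close> plays the role of the Euclidean norm of \<open>\<real>\<^sup>n\<close>.  It is allowed to vanish at nonzero
  vectors, so that it can be the norm of the first \<open>n\<close> coordinates on a larger space.  The
  hypothesis \<open>copy\<close> provides, for each finite set \<open>F\<close>, a pseudometric fulfilling all the conditions
  that concern \<open>F\<close>, extended by zero outside of \<open>F\<close>; compactness yields one that works for
  all finite sets, and \<open>exists_homogeneous_element\<close> finds a norm among those that do.
\<close>

lemma exists_approximable_norm:
  fixes q :: "'v::real_vector \<Rightarrow> real"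
  assumes Z: "asymptotic_subset X d Z dZ"
    and q: "q 0 = 0" "\<And>x. 0 \<le> q x" "\<And>s x. 0 < s \<Longrightarrow> q (s *\<^sub>R x) = s * q x" and L: "0 < L"
    and copy: "\<And>F :: 'v set. finite F \<Longrightarrow> \<exists>g r. 0 < r \<and> g ` F \<subseteq> Z \<and>
      (\<forall>x\<in>F. \<forall>y\<in>F. r * q (y - x) \<le> L * dZ (g x) (g y) \<and> dZ (g x) (g y) \<le> r * (L * q (y - x)))"
  obtains N where "\<And>x. 0 \<le> N x" "\<And>x. N x \<le> L * q x" "\<And>x. q x \<le> L * N x"
    "\<And>a x. N (a *\<^sub>R x) = \<bar>a\<bar> * N x" "\<And>x y. N (x + y) \<le> N x + N y"
    "\<And>F. finite F \<Longrightarrow> approximable_on X d F (\<lambda>(x, y). N (x - y))"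
proof -
  interpret Z: Metric_space Z dZ using Z by (simp add: asymptotic_subset_def)
  define Box where "Box = {\<rho> :: 'v \<times> 'v \<Rightarrow> real. \<forall>p. \<rho> p \<in> {0..L * q (snd p - fst p)}}"
  define metrics where "metrics F = {\<rho> :: 'v \<times> 'v \<Rightarrow> real. \<forall>x\<in>F. \<forall>y\<in>F.
      q (y - x) \<le> L * \<rho> (x, y) \<and> \<rho> (x, y) = \<rho> (y, x) \<and> (\<forall>z\<in>F. \<rho> (x, z) \<le> \<rho> (x, y) + \<rho> (y, z))}" for F
  define D where "D F = metrics F \<inter> {\<rho>. approximable_on X d F \<rho>}" for F
  define C where "C = Box \<inter> (\<Inter>F\<in>Collect finite. D F)"
  have Box: "compact Box" "closed Box" unfolding Box_def by (intro compact_closed_box compact_Icc)+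
  have "closed (metrics F)" for F
  proof -
    have "metrics F = (\<Inter>x\<in>F. \<Inter>y\<in>F. {\<rho>. q (y - x) \<le> L * \<rho> (x, y)} \<inter> {\<rho>. \<rho> (x, y) = \<rho> (y, x)} \<inter>
        (\<Inter>z\<in>F. {\<rho>. \<rho> (x, z) \<le> \<rho> (x, y) + \<rho> (y, z)}))"
      by (auto simp: metrics_def)
    then show ?thesis
      by (simp only:) (intro closed_INT closed_Int ballI closed_Collect_le closed_Collect_eq continuous_intros)
  qed
  then have D_closed: "closed (D F)" if "finite F" for F
    unfolding D_def using closed_approximable_on[OF that] by (intro closed_Int)
  have D_mono: "D G \<subseteq> D F" if "F \<subseteq> G" for F G
  proof -
    have "metrics G \<subseteq> metrics F" unfolding metrics_def using that by blast
    then show ?thesis unfolding D_def using approximable_on_subset that by blast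
  qed
  have D_nonempty: "Box \<inter> D F \<noteq> {}" if F: "finite F" for F
  proof -
    obtain g r where r: "0 < r" and g: "g ` F \<subseteq> Z"
      and lip: "\<And>x y. x \<in> F \<Longrightarrow> y \<in> F \<Longrightarrow>
        r * q (y - x) \<le> L * dZ (g x) (g y) \<and> dZ (g x) (g y) \<le> r * (L * q (y - x))"
      using copy[OF F] by blast
    define \<rho> where "\<rho> = (\<lambda>(x, y). if x \<in> F \<and> y \<in> F then dZ (g x) (g y) / r else 0)"
    have "\<rho> \<in> Box"
      using r lip L q(2)
      by (simp add: Box_def \<rho>_def pos_divide_le_eq mult_ac split: prod.split)
    moreover have "\<rho> \<in> metrics F"
    proof -
      have "\<rho> (x, z) \<le> \<rho> (x, y) + \<rho> (y, z)" if "x \<in> F" "y \<in> F" "z \<in> F" for x y z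
      proof -
        have "g x \<in> Z" "g y \<in> Z" "g z \<in> Z" using g that by auto
        from Z.triangle[OF this] show ?thesis
          using that r by (simp add: \<rho>_def add_divide_distrib[symmetric] divide_right_mono)
      qed
      moreover have "q (y - x) \<le> L * \<rho> (x, y)" if "x \<in> F" "y \<in> F" for x y
        using lip[OF that] that r by (simp add: \<rho>_def pos_le_divide_eq mult_ac)
      moreover have "\<rho> (x, y) = \<rho> (y, x)" for x y by (simp add: \<rho>_def Z.commute)
      ultimately show ?thesis unfolding metrics_def by blast
    qed
    moreover have "approximable_on X d F \<rho>"
      using Z r g by (rule asymptotic_subset_approximable_on) (simp add: \<rho>_def)
    ultimately show ?thesis unfolding D_def by blast
  qed
  have C_nonempty: "C \<noteq> {}"
    unfolding C_def
  proof (rule compact_imp_fip_image[OF Box(1)])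
    fix J :: "'v set set" assume J: "finite J" "J \<subseteq> Collect finite"
    have "Box \<inter> D (\<Union>J) \<noteq> {}" using J by (intro D_nonempty) auto
    moreover have "D (\<Union>J) \<subseteq> (\<Inter>F\<in>J. D F)" using D_mono by blast
    ultimately show "Box \<inter> (\<Inter>F\<in>J. D F) \<noteq> {}" by blast
  qed (use D_closed in simp)
  have C_closed: "closed C" unfolding C_def
    using Box(2) D_closed by (intro closed_Int closed_INT) auto
  have "compact (Box \<inter> C)" using Box(1) C_closed by (rule compact_Int_closed)
  moreover have "Box \<inter> C = C" unfolding C_def by blast
  ultimately have C_compact: "compact C" by simp
  have C_box: "0 \<le> \<rho> (x, y)" "\<rho> (x, y) \<le> L * q (y - x)" if "\<rho> \<in> C" for \<rho> x y
    using that by (auto simp: C_def Box_def)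
  have C_D: "\<rho> \<in> D F" if "\<rho> \<in> C" "finite F" for \<rho> F using that by (simp add: C_def)
  have C_metric: "q (y - x) \<le> L * \<rho> (x, y)" "\<rho> (x, y) = \<rho> (y, x)" "\<rho> (x, z) \<le> \<rho> (x, y) + \<rho> (y, z)"
    if "\<rho> \<in> C" for \<rho> x y z
  proof -
    have "\<rho> \<in> metrics {x, y, z}" using C_D[OF that, of "{x, y, z}"] by (simp add: D_def)
    then show "q (y - x) \<le> L * \<rho> (x, y)" "\<rho> (x, y) = \<rho> (y, x)" "\<rho> (x, z) \<le> \<rho> (x, y) + \<rho> (y, z)"
      unfolding metrics_def by blast+
  qed
  have C_approx: "approximable_on X d F \<rho>" if "\<rho> \<in> C" "finite F" for \<rho> F
    using C_D[OF that] by (simp add: D_def)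
  have C_inv: "homothety_invariant C"
    unfolding homothety_invariant_def
  proof (intro ballI allI impI)
    fix \<rho> s and a :: 'v assume \<rho>: "\<rho> \<in> C" and s: "(0::real) < s"
    have diff: "(a + s *\<^sub>R y) - (a + s *\<^sub>R x) = s *\<^sub>R (y - x)" for x y
      by (simp add: algebra_simps)
    have q_diff: "q ((a + s *\<^sub>R y) - (a + s *\<^sub>R x)) = s * q (y - x)" for x y
      unfolding diff using s by (rule q(3))
    have "0 \<le> rescaled s a \<rho> (x, y)" "rescaled s a \<rho> (x, y) \<le> L * q (y - x)"
      "q (y - x) \<le> L * rescaled s a \<rho> (x, y)" for x y
    proof -
      have "0 \<le> \<rho> (a + s *\<^sub>R x, a + s *\<^sub>R y)"
        "\<rho> (a + s *\<^sub>R x, a + s *\<^sub>R y) \<le> L * (s * q (y - x))"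
        "s * q (y - x) \<le> L * \<rho> (a + s *\<^sub>R x, a + s *\<^sub>R y)"
        using C_box[OF \<rho>] C_metric(1)[OF \<rho>] by (simp_all only: q_diff[symmetric])
      then show "0 \<le> rescaled s a \<rho> (x, y)" "rescaled s a \<rho> (x, y) \<le> L * q (y - x)"
        "q (y - x) \<le> L * rescaled s a \<rho> (x, y)"
        using s by (simp_all add: rescaled_apply pos_divide_le_eq pos_le_divide_eq mult_ac)
    qed
    note bounds = this
    have "rescaled s a \<rho> \<in> Box" using bounds(1,2) by (simp add: Box_def)
    moreover have "rescaled s a \<rho> (x, y) = rescaled s a \<rho> (y, x)" for x y
      using C_metric(2)[OF \<rho>, of "a + s *\<^sub>R x" "a + s *\<^sub>R y"] by (simp add: rescaled_apply)
    moreover have "rescaled s a \<rho> (x, z) \<le> rescaled s a \<rho> (x, y) + rescaled s a \<rho> (y, z)" for x y z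
      using C_metric(3)[OF \<rho>, of "a + s *\<^sub>R x" "a + s *\<^sub>R z" "a + s *\<^sub>R y"] s
      by (simp add: rescaled_apply add_divide_distrib[symmetric] divide_right_mono)
    ultimately have "rescaled s a \<rho> \<in> Box" "rescaled s a \<rho> \<in> metrics F" for F
      using bounds(3) unfolding metrics_def by blast+
    moreover have "approximable_on X d F (rescaled s a \<rho>)" if "finite F" for F
      using C_approx[OF \<rho>] that s by (intro approximable_on_rescaled) auto
    ultimately show "rescaled s a \<rho> \<in> C" unfolding C_def D_def by blast
  qed
  have C_zero: "\<rho> (x, x) = 0" if "\<rho> \<in> C" for \<rho> x
    using C_box[OF that, of x x] q(1) by simp
  obtain \<rho> where \<rho>: "\<rho> \<in> C" and homog: "\<And>x v t. 0 \<le> t \<Longrightarrow> \<rho> (x, x + t *\<^sub>R v) = t * \<rho> (0, v)"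
    by (rule exists_homogeneous_element[where C = C and q = "\<lambda>x. L * q x"])
      (use C_compact C_closed C_nonempty C_inv C_zero C_metric(3) C_box(2) in blast)+
  define N where "N v = \<rho> (0, v)" for v
  have transl: "\<rho> (x, y) = N (y - x)" for x y
    using homog[of 1 x "y - x"] by (simp add: N_def)
  have even: "N (- v) = N v" for v
    using transl[of v 0] transl[of 0 v] C_metric(2)[OF \<rho>, of v 0] by simp
  have N_scale: "N (a *\<^sub>R x) = \<bar>a\<bar> * N x" for a x
  proof (cases "0 \<le> a")
    case True
    then show ?thesis using homog[OF True, of 0 x] by (simp add: N_def)
  next
    case False
    then have "N ((- a) *\<^sub>R x) = (- a) * N x" using homog[of "- a" 0 x] by (simp add: N_def)
    then show ?thesis using False even[of "a *\<^sub>R x"] by simp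
  qed
  show ?thesis
  proof (rule that)
    show "0 \<le> N x" "N x \<le> L * q x" "q x \<le> L * N x" for x
      using C_box[OF \<rho>, of 0 x] C_metric(1)[OF \<rho>, of x 0] by (simp_all add: N_def)
    show "N (a *\<^sub>R x) = \<bar>a\<bar> * N x" for a x by (rule N_scale)
    show "N (x + y) \<le> N x + N y" for x y
      using C_metric(3)[OF \<rho>, of 0 "x + y" x] by (simp add: transl)
    have "(\<lambda>(x, y). N (x - y)) = \<rho>"
      using transl C_metric(2)[OF \<rho>] by fastforce
    then show "approximable_on X d F (\<lambda>(x, y). N (x - y))" if "finite F" for F
      using C_approx[OF \<rho> that] by simp
  qed
qed

text \<open>
  At step \<open>j\<close> approximate a finite net of \<open>B\<close> with accuracy of order \<open>1 / (j + 1)\<close> at a scale beyond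
  \<open>j + 1\<close>.  The image of the net corresponds to \<open>B\<close> by relating the image of a net point to the
  points of \<open>B\<close> near it.
\<close>

lemma approximable_ball_is_limit:
  fixes N :: "'v::real_vector \<Rightarrow> real"
  assumes X: "Metric_space X d" and BM: "Metric_space B (\<lambda>v w. N (v - w))" and B0: "B \<noteq> {}"
    and net: "\<And>\<delta>. 0 < \<delta> \<Longrightarrow> \<exists>F. finite F \<and> F \<subseteq> B \<and> (\<forall>b\<in>B. \<exists>x\<in>F. N (x - b) < \<delta>)"
    and approx: "\<And>F. finite F \<Longrightarrow> approximable_on X d F (\<lambda>(x, y). N (x - y))"
  obtains S R where "\<And>j. S j \<subseteq> X" "\<And>j. 0 < R j" "filterlim R at_top sequentially"
    "gh_converges S (\<lambda>j x y. inverse (R j) * d x y) B (\<lambda>v w. N (v - w))"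
proof -
  interpret X: Metric_space X d by fact
  interpret B: Metric_space B "\<lambda>v w. N (v - w)" by fact
  have "\<exists>S R. S \<subseteq> X \<and> 0 < R \<and> inverse e \<le> R \<and>
      gh_distance S (\<lambda>x y. inverse R * d x y) B (\<lambda>v w. N (v - w)) \<le> ennreal (2 * e)"
    if e: "0 < e" for e :: real
  proof -
    obtain F where F: "finite F" "F \<subseteq> B" "\<And>b. b \<in> B \<Longrightarrow> \<exists>x\<in>F. N (x - b) < e / 2"
      using net[of "e / 2"] e by auto
    obtain R f where R: "inverse e \<le> R" "0 < R" "f ` F \<subseteq> X"
      and f: "\<And>x y. x \<in> F \<Longrightarrow> y \<in> F \<Longrightarrow> \<bar>inverse R * d (f x) (f y) - N (x - y)\<bar> < e / 2"
      using approximable_onD[OF approx[OF F(1)] half_gt_zero[OF e], of "inverse e"] by auto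
    define C where "C = {(f x, b) |x b. x \<in> F \<and> b \<in> B \<and> N (x - b) < e / 2}"
    have "gh_distance (f ` F) (\<lambda>x y. inverse R * d x y) B (\<lambda>v w. N (v - w)) \<le> ennreal (2 * e)"
    proof (rule gh_distance_le_correspondence[where C = C])
      show "Metric_space (f ` F) (\<lambda>x y. inverse R * d x y)"
      proof
        show "inverse R * d x z \<le> inverse R * d x y + inverse R * d y z"
          if "x \<in> f ` F" "y \<in> f ` F" "z \<in> f ` F" for x y z
          using X.triangle[of x y z] that R by (simp add: distrib_left[symmetric] subset_iff)
      qed (use R X.commute in \<open>auto simp: subset_iff\<close>)
      show "Metric_space B (\<lambda>v w. N (v - w))" by fact
      show "C \<subseteq> f ` F \<times> B" by (auto simp: C_def)
      have F_self: "(f x, x) \<in> C" if "x \<in> F" for x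
        using that F(2) e B.zero[of x x] by (auto simp: C_def intro!: exI[of _ x])
      show "fst ` C = f ` F"
      proof
        show "f ` F \<subseteq> fst ` C" using F_self by force
      qed (auto simp: C_def)
      show "snd ` C = B"
      proof
        show "B \<subseteq> snd ` C"
        proof
          fix b assume "b \<in> B"
          then obtain x where "x \<in> F" "N (x - b) < e / 2" using F(3) by blast
          with \<open>b \<in> B\<close> have "(f x, b) \<in> C" by (auto simp: C_def)
          then show "b \<in> snd ` C" by force
        qed
      qed (auto simp: C_def)
      then show "C \<noteq> {}" using B0 by auto
      show "0 < e" by fact
      fix u b u' b' assume "(u, b) \<in> C" "(u', b') \<in> C"
      then obtain x x' where x: "u = f x" "x \<in> F" "b \<in> B" "N (x - b) < e / 2"
        and x': "u' = f x'" "x' \<in> F" "b' \<in> B" "N (x' - b') < e / 2"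
        by (auto simp: C_def)
      have in_B: "x \<in> B" "x' \<in> B" using x x' F(2) by auto
      have "N (x - x') \<le> N (x - b) + N (b - b') + N (b' - x')"
        using B.triangle[of x b x'] B.triangle[of b b' x'] in_B x x' by linarith
      moreover have "N (b - b') \<le> N (b - x) + N (x - x') + N (x' - b')"
        using B.triangle[of b x b'] B.triangle[of x x' b'] in_B x x' by linarith
      ultimately show "\<bar>inverse R * d u u' - N (b - b')\<bar> \<le> 2 * e"
        unfolding x(1) x'(1)
        using f[OF x(2) x'(2)] x(4) x'(4) B.commute[of b x] B.commute[of b' x'] by linarith
    qed
    then show ?thesis using R e by (intro exI[of _ "f ` F"] exI[of _ R]) auto
  qed
  note * = this
  have "\<exists>S R. S \<subseteq> X \<and> 0 < R \<and> real (Suc j) \<le> R \<and>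
      gh_distance S (\<lambda>x y. inverse R * d x y) B (\<lambda>v w. N (v - w)) \<le> ennreal (2 * inverse (real (Suc j)))" for j
    using *[of "inverse (real (Suc j))"] by auto
  then obtain S R where SR: "\<And>j. S j \<subseteq> X" "\<And>j. 0 < R j" "\<And>j. real (Suc j) \<le> R j"
    "\<And>j. gh_distance (S j) (\<lambda>x y. inverse (R j) * d x y) B (\<lambda>v w. N (v - w))
       \<le> ennreal (2 * inverse (real (Suc j)))"
    by metis
  have "filterlim R at_top sequentially"
    using SR(3) by (intro filterlim_at_top_mono[OF filterlim_compose[OF filterlim_real_sequentially filterlim_Suc]])
      auto
  moreover have "gh_converges S (\<lambda>j x y. inverse (R j) * d x y) B (\<lambda>v w. N (v - w))"
    unfolding gh_converges_def
  proof (rule tendsto_sandwich[OF _ _ tendsto_const])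
    have "(\<lambda>j. ennreal (2 * inverse (real (Suc j)))) \<longlonglongrightarrow> ennreal (2 * 0)"
      by (intro tendsto_ennrealI tendsto_mult tendsto_const LIMSEQ_inverse_real_of_nat)
    then show "(\<lambda>j. ennreal (2 * inverse (real (Suc j)))) \<longlonglongrightarrow> 0" by simp
  qed (use SR(4) in auto)
  ultimately show ?thesis using SR(1,2) that by blast
qed

section \<open>Finite-dimensional normed spaces in coordinates\<close>

definition coordinate_space :: "nat \<Rightarrow> (nat \<Rightarrow>\<^sub>0 real) set" where
  "coordinate_space n = {x. Poly_Mapping.keys x \<subseteq> {..<n}}"

lemma lookup_scaleR [simp]:
  "Poly_Mapping.lookup (a *\<^sub>R x) k = a * Poly_Mapping.lookup x k" for x :: "nat \<Rightarrow>\<^sub>0 real"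
proof -
  have "finite {j. a *\<^sub>R Poly_Mapping.lookup x j \<noteq> 0}"
    by (rule finite_subset[OF _ finite_keys[of x]]) (auto simp: in_keys_iff)
  then show ?thesis by (simp add: scaleR_poly_mapping_def)
qed

lemma coordinate_space_iff:
  "x \<in> coordinate_space n \<longleftrightarrow> (\<forall>i. n \<le> i \<longrightarrow> Poly_Mapping.lookup x i = 0)"
  unfolding coordinate_space_def in_keys_iff subset_iff mem_Collect_eq lessThan_iff
  by (meson not_less)

lemma subspace_coordinate_space: "subspace (coordinate_space n)"
  by (auto simp: subspace_def coordinate_space_iff lookup_add)

lemma lookup_sum_single:
  fixes n k :: nat
  shows "Poly_Mapping.lookup (\<Sum>i<n. c i *\<^sub>R Poly_Mapping.single i (1 :: real)) k = (if k < n then c k else 0)"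
proof -
  have "Poly_Mapping.lookup (\<Sum>i<n. c i *\<^sub>R Poly_Mapping.single i (1 :: real)) k
      = (\<Sum>i<n. if i = k then c i else 0)"
    unfolding lookup_sum by (intro sum.cong) (auto simp: lookup_single when_def)
  then show ?thesis by simp
qed

lemma coordinate_space_basis:
  "\<exists>B. finite B \<and> independent B \<and> span B = coordinate_space n \<and> card B = n"
proof (intro exI conjI)
  define e :: "nat \<Rightarrow> (nat \<Rightarrow>\<^sub>0 real)" where "e i = Poly_Mapping.single i 1" for i
  have inj: "inj_on e A" for A
  proof (rule inj_onI)
    fix i j assume "e i = e j"
    then have "Poly_Mapping.lookup (e i) i = Poly_Mapping.lookup (e j) i" by simp
    then show "i = j" by (simp add: e_def lookup_single when_def split: if_splits)
  qed
  show fin: "finite (e ` {..<n})" by simp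
  show "card (e ` {..<n}) = n" using inj by (simp add: card_image)
  show "independent (e ` {..<n})"
    unfolding dependent_finite[OF fin]
  proof safe
    fix u i assume u: "(\<Sum>v\<in>e ` {..<n}. u v *\<^sub>R v) = 0" and i: "i < n" and ne: "u (e i) \<noteq> 0"
    have "(\<Sum>j<n. u (e j) *\<^sub>R e j) = 0" using u by (simp add: sum.reindex[OF inj])
    then have "Poly_Mapping.lookup (\<Sum>j<n. u (e j) *\<^sub>R e j) i = 0" by simp
    then have "u (e i) = 0"
      unfolding e_def[of "_ :: nat", abs_def] lookup_sum_single using i by simp
    with ne show False by simp
  qed
  show "span (e ` {..<n}) = coordinate_space n"
  proof
    show "span (e ` {..<n}) \<subseteq> coordinate_space n"
      by (intro span_minimal subspace_coordinate_space)
        (auto simp: e_def coordinate_space_iff lookup_single when_def)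
    show "coordinate_space n \<subseteq> span (e ` {..<n})"
    proof
      fix x assume x: "x \<in> coordinate_space n"
      have "x = (\<Sum>i<n. Poly_Mapping.lookup x i *\<^sub>R e i)"
        unfolding e_def using x
        by (intro poly_mapping_eqI) (auto simp: lookup_sum_single coordinate_space_iff)
      also have "\<dots> \<in> span (e ` {..<n})"
        by (intro span_sum span_scale span_base) auto
      finally show "x \<in> span (e ` {..<n})" .
    qed
  qed
qed

text \<open>
  Choose one point of \<open>B\<close> in each cell of a grid of mesh \<open>\<delta>\<close>; boundedness leaves finitely many cells.
\<close>

lemma coordinate_space_net:
  fixes B :: "(nat \<Rightarrow>\<^sub>0 real) set"
  assumes B: "\<And>x i. x \<in> B \<Longrightarrow> i < n \<Longrightarrow> \<bar>Poly_Mapping.lookup x i\<bar> \<le> M" and \<delta>: "0 < \<delta>"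
  obtains F where "finite F" "F \<subseteq> B"
    "\<And>b. b \<in> B \<Longrightarrow> \<exists>x\<in>F. \<forall>i<n. \<bar>Poly_Mapping.lookup x i - Poly_Mapping.lookup b i\<bar> < \<delta>"
proof -
  define cell where "cell x = (\<lambda>i\<in>{..<n}. \<lfloor>Poly_Mapping.lookup x i / \<delta>\<rfloor>)" for x :: "nat \<Rightarrow>\<^sub>0 real"
  define F where "F = inv_into B cell ` cell ` B"
  have "cell ` B \<subseteq> Pi\<^sub>E {..<n} (\<lambda>_. {\<lfloor>- M / \<delta>\<rfloor>..\<lfloor>M / \<delta>\<rfloor>})"
  proof
    fix c assume "c \<in> cell ` B"
    then obtain x where x: "c = cell x" "x \<in> B" by blast
    have "\<lfloor>- M / \<delta>\<rfloor> \<le> c i \<and> c i \<le> \<lfloor>M / \<delta>\<rfloor>" if "i < n" for i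
    proof -
      have "- M \<le> Poly_Mapping.lookup x i" "Poly_Mapping.lookup x i \<le> M"
        using B[OF x(2) that] by linarith+
      then have "- M / \<delta> \<le> Poly_Mapping.lookup x i / \<delta>" "Poly_Mapping.lookup x i / \<delta> \<le> M / \<delta>"
        using \<delta> divide_right_mono[OF _ less_imp_le[OF \<delta>]] by blast+
      then show ?thesis using that by (simp add: x cell_def floor_mono)
    qed
    then show "c \<in> Pi\<^sub>E {..<n} (\<lambda>_. {\<lfloor>- M / \<delta>\<rfloor>..\<lfloor>M / \<delta>\<rfloor>})"
      by (auto simp: x cell_def)
  qed
  then have "finite (cell ` B)" by (rule finite_subset) (intro finite_PiE, auto)
  then have "finite F" by (simp add: F_def)
  moreover have "F \<subseteq> B" unfolding F_def by (auto intro: inv_into_into)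
  moreover have "\<exists>x\<in>F. \<forall>i<n. \<bar>Poly_Mapping.lookup x i - Poly_Mapping.lookup b i\<bar> < \<delta>" if b: "b \<in> B" for b
  proof -
    define x where "x = inv_into B cell (cell b)"
    have "x \<in> F" using b by (simp add: F_def x_def)
    have "cell x = cell b" using b unfolding x_def by (intro f_inv_into_f) simp
    then have same_cell: "cell x i = cell b i" for i by simp
    have *: "\<lfloor>Poly_Mapping.lookup x i / \<delta>\<rfloor> = \<lfloor>Poly_Mapping.lookup b i / \<delta>\<rfloor>" if "i < n" for i
      using that same_cell[of i] by (simp add: cell_def)
    have "\<forall>i<n. \<bar>Poly_Mapping.lookup x i - Poly_Mapping.lookup b i\<bar> < \<delta>"
    proof (intro allI impI)
      fix i assume "i < n"
      have "\<bar>(Poly_Mapping.lookup x i - Poly_Mapping.lookup b i) / \<delta>\<bar> < 1"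
        using *[OF \<open>i < n\<close>] floor_correct[of "Poly_Mapping.lookup x i / \<delta>"]
          floor_correct[of "Poly_Mapping.lookup b i / \<delta>"]
        unfolding diff_divide_distrib by linarith
      then show "\<bar>Poly_Mapping.lookup x i - Poly_Mapping.lookup b i\<bar> < \<delta>"
        using \<delta> by (simp add: abs_divide)
    qed
    with \<open>x \<in> F\<close> show ?thesis by blast
  qed
  ultimately show ?thesis using that by blast
qed

lemma abs_le_L2_set:
  assumes "finite A" "i \<in> A"
  shows "\<bar>f i\<bar> \<le> L2_set f A"
proof -
  have "\<bar>f i\<bar> \<le> L2_set (\<lambda>i. \<bar>f i\<bar>) A" using assms by (rule member_le_L2_set)
  then show ?thesis by (simp add: L2_set_def)
qed

lemma norm_of_combination_le:
  fixes e :: "nat \<Rightarrow> 'v::real_vector"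
  assumes V: "normed_space_of_dim m V N" and e: "\<And>i. i < n \<Longrightarrow> e i \<in> V"
  shows "N (\<Sum>i<n. x i *\<^sub>R e i) \<le> (\<Sum>i<n. \<bar>x i\<bar> * N (e i))"
proof -
  note V' = V[unfolded normed_space_of_dim_def]
  have sub: "subspace V" using V' by simp
  have zero: "N 0 = 0" using V' subspace_0[OF sub] by simp
  have scale: "N (a *\<^sub>R v) = \<bar>a\<bar> * N v" if "v \<in> V" for a v using V' that by simp
  have tri: "N (v + w) \<le> N v + N w" if "v \<in> V" "w \<in> V" for v w using V' that by simp
  show ?thesis
    using e
  proof (induction n)
    case (Suc n)
    have "(\<Sum>i<n. x i *\<^sub>R e i) \<in> V" "x n *\<^sub>R e n \<in> V"
      using Suc.prems by (auto intro!: subspace_sum subspace_scale sub)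
    from tri[OF this] show ?case using Suc scale[of "e n" "x n"] by simp
  qed (simp add: zero)
qed

text \<open>
  The norm is continuous in the coordinates, and the unit sphere of the sum norm is compact when
  the coordinates beyond \<open>n\<close> are fixed to be zero.
\<close>

lemma norm_of_combination_ge_coordinates:
  fixes e :: "nat \<Rightarrow> 'v::real_vector"
  assumes V: "normed_space_of_dim n V N" and e: "\<And>i. i < n \<Longrightarrow> e i \<in> V"
    and indep: "\<And>x. (\<Sum>i<n. x i *\<^sub>R e i) = 0 \<Longrightarrow> \<forall>i<n. x i = 0"
  obtains c where "0 < c" "\<And>x. c * (\<Sum>i<n. \<bar>x i\<bar>) \<le> N (\<Sum>i<n. x i *\<^sub>R e i)"
proof -
  note V' = V[unfolded normed_space_of_dim_def]
  have sub: "subspace V" using V' by simp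
  have N: "\<And>x. x \<in> V \<Longrightarrow> 0 \<le> N x" "\<And>x. x \<in> V \<Longrightarrow> N x = 0 \<longleftrightarrow> x = 0"
    "\<And>x a. x \<in> V \<Longrightarrow> N (a *\<^sub>R x) = \<bar>a\<bar> * N x"
    "\<And>x y. x \<in> V \<Longrightarrow> y \<in> V \<Longrightarrow> N (x + y) \<le> N x + N y"
    using V' by simp_all
  define T where "T x = (\<Sum>i<n. x i *\<^sub>R e i)" for x :: "nat \<Rightarrow> real"
  have TV: "T x \<in> V" for x unfolding T_def using e by (intro subspace_sum subspace_scale sub) auto
  have T_diff: "T x - T y = T (\<lambda>i. x i - y i)" for x y
    by (simp add: T_def sum_subtractf scaleR_diff_left)
  have T_le: "N (T x) \<le> (\<Sum>i<n. \<bar>x i\<bar> * N (e i))" for x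
    unfolding T_def using V e by (rule norm_of_combination_le) auto
  have cont: "continuous_on A (\<lambda>x. N (T x))" for A
    unfolding continuous_on_def
  proof
    fix x assume "x \<in> A"
    define h where "h y = (\<Sum>i<n. \<bar>y i - x i\<bar> * N (e i))" for y
    have "continuous_on A h" unfolding h_def by (intro continuous_intros)
    then have "(h \<longlongrightarrow> h x) (at x within A)" using \<open>x \<in> A\<close> by (simp add: continuous_on_def)
    then have h: "(h \<longlongrightarrow> 0) (at x within A)" by (simp add: h_def)
    have h_sym: "h y = (\<Sum>i<n. \<bar>x i - y i\<bar> * N (e i))" for y
      unfolding h_def by (simp add: abs_minus_commute)
    have up: "N (T y) \<le> N (T x) + h y" for y
      using N(4)[OF TV[of x] TV[of "\<lambda>i. y i - x i"]] T_le[of "\<lambda>i. y i - x i"]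
      unfolding T_diff[symmetric] h_def by simp
    have low: "N (T x) - h y \<le> N (T y)" for y
      using N(4)[OF TV[of y] TV[of "\<lambda>i. x i - y i"]] T_le[of "\<lambda>i. x i - y i"]
      unfolding T_diff[symmetric] h_sym by simp
    show "((\<lambda>x. N (T x)) \<longlongrightarrow> N (T x)) (at x within A)"
    proof (rule tendsto_sandwich)
      show "((\<lambda>y. N (T x) - h y) \<longlongrightarrow> N (T x)) (at x within A)"
        using tendsto_diff[OF tendsto_const h, of "N (T x)"] by simp
      show "((\<lambda>y. N (T x) + h y) \<longlongrightarrow> N (T x)) (at x within A)"
        using tendsto_add[OF tendsto_const h, of "N (T x)"] by simp
    qed (use low up in auto)
  qed
  define Q where "Q = {x :: nat \<Rightarrow> real. \<forall>i. x i \<in> (if i < n then {-1..1} else {0})}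
      \<inter> {x. (\<Sum>i<n. \<bar>x i\<bar>) = 1}"
  have "compact Q" unfolding Q_def
    by (intro compact_Int_closed compact_closed_box closed_Collect_eq continuous_intros) auto
  have "\<exists>c>0. \<forall>x\<in>Q. c \<le> N (T x)"
  proof (cases "Q = {}")
    case False
    then obtain x where x: "x \<in> Q" "\<And>y. y \<in> Q \<Longrightarrow> N (T x) \<le> N (T y)"
      using continuous_attains_inf[OF \<open>compact Q\<close> False cont] by blast
    have "T x \<noteq> 0"
    proof
      assume "T x = 0"
      then have "\<forall>i<n. x i = 0" using indep by (simp add: T_def)
      with x(1) show False by (simp add: Q_def)
    qed
    then have "0 < N (T x)" using N(1,2)[OF TV[of x]] by (simp add: less_le)
    with x(2) show ?thesis by blast
  qed (auto intro: exI[of _ 1])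
  then obtain c where c: "0 < c" "\<And>x. x \<in> Q \<Longrightarrow> c \<le> N (T x)" by blast
  have "c * (\<Sum>i<n. \<bar>x i\<bar>) \<le> N (T x)" for x
  proof -
    define s where "s = (\<Sum>i<n. \<bar>x i\<bar>)"
    show ?thesis
    proof (cases "s = 0")
      case True
      then show ?thesis using N(1)[OF TV] by (simp add: s_def)
    next
      case False
      have s: "0 < s" using False by (simp add: s_def sum_nonneg less_le)
      define y where "y i = (if i < n then x i / s else 0)" for i
      have x_le: "\<bar>x i\<bar> \<le> s" if "i < n" for i
        unfolding s_def using that by (intro member_le_sum) auto
      have y_abs: "\<bar>y i\<bar> \<le> 1" for i
        using x_le[of i] s by (simp add: y_def abs_divide)
      have "(\<Sum>i<n. \<bar>y i\<bar>) = (\<Sum>i<n. \<bar>x i\<bar> / s)"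
        using s by (intro sum.cong) (simp_all add: y_def abs_divide)
      also have "\<dots> = 1" unfolding sum_divide_distrib[symmetric] s_def[symmetric] using s by simp
      finally have "(\<Sum>i<n. \<bar>y i\<bar>) = 1" .
      moreover have "y i \<in> {-1..1}" for i using y_abs[of i] by (simp add: abs_le_iff)
      moreover have "y i = 0" if "\<not> i < n" for i using that by (simp add: y_def)
      ultimately have "y \<in> Q" by (simp add: Q_def)
      then have "c \<le> N (T y)" by (rule c(2))
      also have "T y = inverse s *\<^sub>R T x"
        unfolding T_def scaleR_sum_right by (intro sum.cong) (simp_all add: y_def divide_inverse mult.commute)
      also have "N \<dots> = inverse s * N (T x)" using N(3)[OF TV, of "inverse s"] s by simp
      finally show ?thesis using s by (simp add: s_def[symmetric] inverse_eq_divide pos_le_divide_eq)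
    qed
  qed
  with c(1) that show ?thesis unfolding T_def by blast
qed

lemma normed_space_of_dim_coordinates:
  assumes V: "normed_space_of_dim n V N"
  obtains e where "\<And>i. i < n \<Longrightarrow> e i \<in> V" "\<And>x. (\<Sum>i<n. x i *\<^sub>R e i) = 0 \<Longrightarrow> \<forall>i<n. x i = (0 :: real)"
proof -
  obtain B where B: "finite B" "independent B" "span B = V" "card B = n"
    using V unfolding normed_space_of_dim_def by blast
  obtain e where e: "bij_betw e {..<n} B"
    using B(1,4) ex_bij_betw_nat_finite[of B] by (auto simp: atLeast0LessThan)
  have "\<forall>i<n. x i = 0" if x: "(\<Sum>i<n. x i *\<^sub>R e i) = 0" for x :: "nat \<Rightarrow> real"
  proof -
    define u where "u b = x (inv_into {..<n} e b)" for b
    have inv: "u (e i) = x i" if "i < n" for i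
      using e that by (simp add: u_def bij_betw_def)
    have "(\<Sum>b\<in>B. u b *\<^sub>R b) = (\<Sum>i<n. u (e i) *\<^sub>R e i)"
      by (rule sum.reindex_bij_betw[OF e, symmetric])
    also have "\<dots> = 0" using x inv by simp
    finally have "\<forall>b\<in>B. u b = 0" using B(2) unfolding dependent_finite[OF B(1)] by blast
    then have "u (e i) = 0" if "i < n" for i using e that by (auto simp: bij_betw_def)
    with inv show ?thesis by simp
  qed
  moreover have "e i \<in> V" if "i < n" for i
    using e that B(3) span_superset[of B] by (auto simp: bij_betw_def)
  ultimately show ?thesis using that by blast
qed

section \<open>Comparison of the two families of dimensions\<close>

text \<open>
  The homothetic copies of finite sets inside \<open>K\<close> are carried by \<open>\<phi>\<close> to \<open>Z\<close>, which supplies the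
  pseudometrics that \<open>exists_approximable_norm\<close> needs.
\<close>

lemma bilipschitz_image_imp_ball_limit:
  fixes X :: "'a set"
  assumes X: "Metric_space X d" and Z: "asymptotic_subset X d Z dZ"
    and K: "compactin (product_topology (\<lambda>_. euclideanreal) {..<n}) K"
    and pos: "0 < emeasure (\<Pi>\<^sub>M i\<in>{..<n}. lborel) K"
    and \<phi>: "bilipschitz_embedding K (euclid_dist n) Z dZ \<phi>"
  shows "\<exists>(V :: (nat \<Rightarrow>\<^sub>0 real) set) N (S :: nat \<Rightarrow> 'a set) (R :: nat \<Rightarrow> real).
           normed_space_of_dim n V N \<and>
           (\<forall>j. S j \<subseteq> X) \<and> (\<forall>j. 0 < R j) \<and> filterlim R at_top sequentially \<and>
           gh_converges S (\<lambda>j x y. inverse (R j) * d x y)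
             (closed_unit_ball V N) (\<lambda>v w. N (v - w))"
proof -
  let ?lk = "Poly_Mapping.lookup :: (nat \<Rightarrow>\<^sub>0 real) \<Rightarrow> nat \<Rightarrow> real"
  define q where "q x = L2_set (?lk x) {..<n}" for x
  obtain L where L: "0 < L" and \<phi>Z: "\<phi> \<in> K \<rightarrow> Z"
    and lip: "\<And>x y. x \<in> K \<Longrightarrow> y \<in> K \<Longrightarrow> inverse L * euclid_dist n x y \<le> dZ (\<phi> x) (\<phi> y)
      \<and> dZ (\<phi> x) (\<phi> y) \<le> L * euclid_dist n x y"
    using \<phi> unfolding bilipschitz_embedding_def by blast
  have q0: "q 0 = 0" by (simp add: q_def L2_set_def)
  have q_nonneg: "0 \<le> q x" for x by (simp add: q_def)
  have q_scale: "q (s *\<^sub>R x) = s * q x" if "0 < s" for s x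
  proof -
    have "?lk (s *\<^sub>R x) = (\<lambda>i. s * ?lk x i)" by (rule ext) simp
    then show ?thesis using that by (simp add: q_def L2_set_right_distrib)
  qed
  have copy: "\<exists>g r. 0 < r \<and> g ` F \<subseteq> Z \<and>
      (\<forall>x\<in>F. \<forall>y\<in>F. r * q (y - x) \<le> L * dZ (g x) (g y) \<and> dZ (g x) (g y) \<le> r * (L * q (y - x)))"
    if F: "finite F" for F :: "(nat \<Rightarrow>\<^sub>0 real) set"
  proof -
    obtain a r where r: "0 < r" and a: "\<And>c. c \<in> ?lk ` F \<Longrightarrow> (\<lambda>i\<in>{..<n}. a i + r * c i) \<in> K"
      by (rule positive_measure_contains_homothetic_copy[OF K pos finite_imageI[OF F, of ?lk]]) (rule that)
    define h where "h x = (\<lambda>i\<in>{..<n}. a i + r * ?lk x i)" for x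
    have hK: "h x \<in> K" if "x \<in> F" for x unfolding h_def by (rule a) (use that in blast)
    have dist: "euclid_dist n (h x) (h y) = r * q (y - x)" for x y
    proof -
      have "euclid_dist n (h x) (h y) = L2_set (\<lambda>i. h x i - h y i) {..<n}"
        by (simp add: euclid_dist_def)
      also have "\<dots> = L2_set (\<lambda>i. r * ?lk (y - x) i) {..<n}"
        unfolding L2_set_def
        by (intro arg_cong[where f = sqrt] sum.cong refl)
          (simp add: h_def lookup_minus power2_eq_square algebra_simps)
      finally show ?thesis using r by (simp add: q_def L2_set_right_distrib)
    qed
    show ?thesis
    proof (intro exI conjI ballI)
      show "0 < r" by fact
      show "(\<lambda>x. \<phi> (h x)) ` F \<subseteq> Z" using \<phi>Z hK by blast
      fix x y assume "x \<in> F" "y \<in> F"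
      then have "inverse L * (r * q (y - x)) \<le> dZ (\<phi> (h x)) (\<phi> (h y))"
        "dZ (\<phi> (h x)) (\<phi> (h y)) \<le> L * (r * q (y - x))"
        using lip[of "h x" "h y"] hK unfolding dist by auto
      then show "r * q (y - x) \<le> L * dZ (\<phi> (h x)) (\<phi> (h y))"
        "dZ (\<phi> (h x)) (\<phi> (h y)) \<le> r * (L * q (y - x))"
        using L by (simp_all add: inverse_eq_divide pos_divide_le_eq mult_ac)
    qed
  qed
  obtain N where N_nonneg: "\<And>x. 0 \<le> N x" and N_le: "\<And>x. N x \<le> L * q x"
    and N_ge: "\<And>x. q x \<le> L * N x"
    and N_scale: "\<And>a x. N (a *\<^sub>R x) = \<bar>a\<bar> * N x" and N_tri: "\<And>x y. N (x + y) \<le> N x + N y"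
    and approx: "\<And>F. finite F \<Longrightarrow> approximable_on X d F (\<lambda>(x, y). N (x - y))"
    using exists_approximable_norm[OF Z q0 q_nonneg q_scale L copy] by blast
  define V where "V = coordinate_space n"
  note sub = subspace_coordinate_space[of n, folded V_def]
  have N_zero: "N x = 0 \<longleftrightarrow> x = 0" if "x \<in> V" for x
  proof
    assume "N x = 0"
    then have "q x = 0" using N_ge[of x] q_nonneg[of x] by simp
    then have "\<forall>i<n. ?lk x i = 0" by (auto simp: q_def L2_set_eq_0_iff)
    then show "x = 0" using that
      by (intro poly_mapping_eqI) (metis V_def coordinate_space_iff lookup_zero not_less)
  next
    assume "x = 0" then show "N x = 0" using N_scale[of 0 x] by simp
  qed
  have normed: "normed_space_of_dim n V N"
    unfolding normed_space_of_dim_def V_def[symmetric]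
    using sub coordinate_space_basis[of n, folded V_def] N_nonneg N_zero N_scale N_tri by simp
  define B where "B = closed_unit_ball V N"
  have BV: "B \<subseteq> V" by (auto simp: B_def closed_unit_ball_def)
  have N_neg: "N (- x) = N x" for x using N_scale[of "- 1" x] by simp
  have metric: "Metric_space B (\<lambda>v w. N (v - w))"
  proof
    show "N (x - y) = N (y - x)" for x y using N_neg[of "x - y"] by simp
    show "N (x - y) = 0 \<longleftrightarrow> x = y" if "x \<in> B" "y \<in> B" for x y
    proof -
      have "x - y \<in> V" using that BV sub by (blast intro: subspace_diff)
      from N_zero[OF this] show ?thesis by simp
    qed
    show "N (x - z) \<le> N (x - y) + N (y - z)" for x y z using N_tri[of "x - y" "y - z"] by simp
  qed (rule N_nonneg)
  have "0 \<in> B" using sub subspace_0 N_zero[of 0] by (auto simp: B_def closed_unit_ball_def)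
  then have B_ne: "B \<noteq> {}" by blast
  have net: "\<exists>F. finite F \<and> F \<subseteq> B \<and> (\<forall>b\<in>B. \<exists>x\<in>F. N (x - b) < \<delta>)" if \<delta>: "0 < \<delta>" for \<delta>
  proof -
    define \<eta> where "\<eta> = \<delta> / (L * (real n + 1))"
    have \<eta>: "0 < \<eta>" using \<delta> L by (simp add: \<eta>_def)
    have bdd: "\<bar>?lk x i\<bar> \<le> L" if "x \<in> B" "i < n" for x i
    proof -
      have "\<bar>?lk x i\<bar> \<le> q x"
        using that unfolding q_def by (intro abs_le_L2_set) auto
      also have "\<dots> \<le> L * N x" by (rule N_ge)
      also have "\<dots> \<le> L * 1" using that L by (intro mult_left_mono) (auto simp: B_def closed_unit_ball_def)
      finally show ?thesis by simp
    qed
    obtain F where F: "finite F" "F \<subseteq> B"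
      "\<And>b. b \<in> B \<Longrightarrow> \<exists>x\<in>F. \<forall>i<n. \<bar>?lk x i - ?lk b i\<bar> < \<eta>"
      by (rule coordinate_space_net[of B n L \<eta>, OF bdd \<eta>]) (assumption | rule that)+
    have "N (x - b) < \<delta>" if close: "\<forall>i<n. \<bar>?lk x i - ?lk b i\<bar> < \<eta>" for x b
    proof -
      have "q (x - b) \<le> (\<Sum>i<n. \<bar>?lk (x - b) i\<bar>)" unfolding q_def by (rule L2_set_le_sum_abs)
      also have "\<dots> \<le> (\<Sum>i<n. \<eta>)"
        using close by (intro sum_mono) (auto simp: lookup_minus less_imp_le)
      also have "\<dots> < (real n + 1) * \<eta>" using \<eta> by simp
      finally have "L * q (x - b) < L * ((real n + 1) * \<eta>)" using L by simp
      also have "\<dots> = \<delta>" using L by (simp add: \<eta>_def)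
      finally show ?thesis using N_le[of "x - b"] by linarith
    qed
    then have "\<forall>b\<in>B. \<exists>x\<in>F. N (x - b) < \<delta>" using F(3) by meson
    with F(1,2) show ?thesis by (intro exI[of _ F]) simp
  qed
  obtain S R where "\<And>j. S j \<subseteq> X" "\<And>j. 0 < R j" "filterlim R at_top sequentially"
    "gh_converges S (\<lambda>j x y. inverse (R j) * d x y) B (\<lambda>v w. N (v - w))"
    using approximable_ball_is_limit[OF X metric B_ne net approx] by blast
  with normed show ?thesis unfolding B_def
    by (intro exI[of _ V] exI[of _ N] exI[of _ S] exI[of _ R]) simp
qed

text \<open>
  The cube has side \<open>2 / A\<close>, where \<open>A\<close> exceeds the sum of the norms of the basis vectors, so that
  the linear parametrisation maps it into the unit ball.
\<close>

lemma ball_limit_imp_bilipschitz_image: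
  fixes X :: "'a set" and V :: "'v::real_vector set"
  assumes V: "normed_space_of_dim n V N"
    and S: "\<forall>j. S j \<subseteq> X" "\<forall>j. 0 < R j" "filterlim R at_top sequentially"
    and lim: "gh_converges S (\<lambda>j x y. inverse (R j) * d x y) (closed_unit_ball V N) (\<lambda>v w. N (v - w))"
  shows "\<exists>(Z :: (nat \<Rightarrow> 'a) set) dZ (K :: (nat \<Rightarrow> real) set) \<phi>.
            asymptotic_subset X d Z dZ \<and>
            compactin (product_topology (\<lambda>_. euclideanreal) {..<n}) K \<and>
            0 < emeasure (\<Pi>\<^sub>M i\<in>{..<n}. lborel) K \<and>
            bilipschitz_embedding K (euclid_dist n) Z dZ \<phi>"
proof -
  note V' = V[unfolded normed_space_of_dim_def]
  have sub: "subspace V" using V' by simp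
  have N: "\<And>x. x \<in> V \<Longrightarrow> 0 \<le> N x" "\<And>x. x \<in> V \<Longrightarrow> N x = 0 \<longleftrightarrow> x = 0"
    "\<And>x a. x \<in> V \<Longrightarrow> N (a *\<^sub>R x) = \<bar>a\<bar> * N x"
    "\<And>x y. x \<in> V \<Longrightarrow> y \<in> V \<Longrightarrow> N (x + y) \<le> N x + N y"
    using V' by simp_all
  define B where "B = closed_unit_ball V N"
  define dB where "dB v w = (if v \<in> V \<and> w \<in> V then N (v - w) else 0)" for v w
  have BV: "B \<subseteq> V" by (auto simp: B_def closed_unit_ball_def)
  have metric: "Metric_space B dB"
  proof
    show "0 \<le> dB x y" for x y using N(1) sub by (simp add: dB_def subspace_diff)
    show "dB x y = dB y x" for x y
      using N(3)[of "x - y" "- 1"] sub by (auto simp: dB_def subspace_diff)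
    show "dB x y = 0 \<longleftrightarrow> x = y" if "x \<in> B" "y \<in> B" for x y
    proof -
      have "x \<in> V" "y \<in> V" using that BV by auto
      then show ?thesis using N(2)[of "x - y"] sub by (simp add: dB_def subspace_diff)
    qed
    show "dB x z \<le> dB x y + dB y z" if "x \<in> B" "y \<in> B" "z \<in> B" for x y z
    proof -
      have "x \<in> V" "y \<in> V" "z \<in> V" using that BV by auto
      then show ?thesis using N(4)[of "x - y" "y - z"] sub by (simp add: dB_def subspace_diff)
    qed
  qed
  have "gh_distance (S j) dA B (\<lambda>v w. N (v - w)) = gh_distance (S j) dA B dB" for j and dA
    using BV by (intro gh_distance_cong) (auto simp: dB_def)
  then have "gh_converges S (\<lambda>j x y. inverse (R j) * d x y) B dB"
    using lim by (simp add: gh_converges_def B_def)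
  with metric S have "asymptotic_subset X d B dB" unfolding asymptotic_subset_def by blast
  then obtain h :: "'v \<Rightarrow> nat \<Rightarrow> 'a" and dZ where Z: "asymptotic_subset X d (h ` B) dZ"
    and h: "isometric_embedding B dB (h ` B) dZ h"
    by (rule asymptotic_subset_universe)
  obtain e where eV: "\<And>i. i < n \<Longrightarrow> e i \<in> V"
    and indep: "\<And>x. (\<Sum>i<n. x i *\<^sub>R e i) = 0 \<Longrightarrow> \<forall>i<n. x i = (0 :: real)"
    using normed_space_of_dim_coordinates[OF V] by blast
  define T where "T x = (\<Sum>i<n. x i *\<^sub>R e i)" for x :: "nat \<Rightarrow> real"
  obtain c where c: "0 < c" "\<And>x. c * (\<Sum>i<n. \<bar>x i\<bar>) \<le> N (T x)"
    using norm_of_combination_ge_coordinates[where e = e, OF V eV indep] unfolding T_def by blast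
  have TV: "T x \<in> V" for x unfolding T_def using eV by (intro subspace_sum subspace_scale sub) auto
  have T_diff: "T x - T y = T (\<lambda>i. x i - y i)" for x y
    by (simp add: T_def sum_subtractf scaleR_diff_left)
  define A where "A = 1 + (\<Sum>i<n. N (e i))"
  have eN: "0 \<le> (\<Sum>i<n. N (e i))" using eV N(1) by (intro sum_nonneg) auto
  then have A: "0 < A" by (simp add: A_def)
  have T_le: "N (T x) \<le> A * M" if M: "\<And>i. i < n \<Longrightarrow> \<bar>x i\<bar> \<le> M" "0 \<le> M" for x M
  proof -
    have "N (T x) \<le> (\<Sum>i<n. \<bar>x i\<bar> * N (e i))"
      unfolding T_def using V eV by (rule norm_of_combination_le) auto
    also have "\<dots> \<le> (\<Sum>i<n. M * N (e i))"
      using M(1) eV N(1) by (intro sum_mono mult_right_mono) auto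
    also have "\<dots> = M * (\<Sum>i<n. N (e i))" by (simp add: sum_distrib_left)
    also have "\<dots> \<le> A * M" using M(2) by (simp add: A_def algebra_simps)
    finally show ?thesis .
  qed
  define K where "K = Pi\<^sub>E {..<n} (\<lambda>_. {- inverse A..inverse A})"
  have TB: "T x \<in> B" if "x \<in> K" for x
  proof -
    have "\<bar>x i\<bar> \<le> inverse A" if "i < n" for i
      using \<open>x \<in> K\<close> that by (force simp: K_def PiE_def Pi_def abs_le_iff)
    from T_le[OF this] show ?thesis using A TV by (simp add: B_def closed_unit_ball_def)
  qed
  have "compactin (product_topology (\<lambda>_. euclideanreal) {..<n}) K"
    unfolding K_def by (simp add: compactin_PiE)
  moreover have "0 < emeasure (\<Pi>\<^sub>M i\<in>{..<n}. lborel) K"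
  proof -
    interpret product_sigma_finite "\<lambda>_ :: nat. lborel :: real measure" by standard
    have "emeasure (\<Pi>\<^sub>M i\<in>{..<n}. lborel) K = (\<Prod>i<n. emeasure lborel {- inverse A..inverse A})"
      unfolding K_def by (intro emeasure_PiM) auto
    also have "\<dots> = ennreal (2 * inverse A) ^ n" using A by (simp add: emeasure_lborel_Icc_eq)
    also have "\<dots> = ennreal ((2 * inverse A) ^ n)" using A by (intro ennreal_power) simp
    finally show ?thesis using A by simp
  qed
  moreover have "bilipschitz_embedding K (euclid_dist n) (h ` B) dZ (\<lambda>x. h (T x))"
    unfolding bilipschitz_embedding_def
  proof (intro conjI exI ballI)
    show "(\<lambda>x. h (T x)) \<in> K \<rightarrow> h ` B" using TB by blast
    show "0 < A + inverse c" using A c(1) by (simp add: add_pos_pos)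
    fix x y assume xy: "x \<in> K" "y \<in> K"
    define z where "z = (\<lambda>i. x i - y i)"
    have dZ: "dZ (h (T x)) (h (T y)) = N (T z)"
      using h TB[OF xy(1)] TB[OF xy(2)] TV T_diff[of x y]
      by (simp add: isometric_embedding_def dB_def z_def)
    have ed: "euclid_dist n x y = L2_set z {..<n}" by (simp add: euclid_dist_def z_def)
    have nn: "0 \<le> L2_set z {..<n}" by simp
    have "inverse (A + inverse c) * L2_set z {..<n} \<le> c * L2_set z {..<n}"
    proof (rule mult_right_mono[OF _ nn])
      have "inverse (A + inverse c) \<le> inverse (inverse c)"
        using A c(1) by (intro le_imp_inverse_le) auto
      then show "inverse (A + inverse c) \<le> c" by simp
    qed
    also have "\<dots> \<le> c * (\<Sum>i<n. \<bar>z i\<bar>)"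
      using c(1) by (intro mult_left_mono L2_set_le_sum_abs) simp
    also have "\<dots> \<le> N (T z)" by (rule c(2))
    finally show "inverse (A + inverse c) * euclid_dist n x y \<le> dZ (h (T x)) (h (T y))"
      unfolding dZ ed .
    have "\<bar>z i\<bar> \<le> L2_set z {..<n}" if "i < n" for i
      using that by (intro abs_le_L2_set) auto
    then have "N (T z) \<le> A * L2_set z {..<n}" using nn by (rule T_le)
    also have "\<dots> \<le> (A + inverse c) * L2_set z {..<n}"
      using c(1) nn by (intro mult_right_mono) auto
    finally show "dZ (h (T x)) (h (T y)) \<le> (A + inverse c) * euclid_dist n x y"
      unfolding dZ ed .
  qed
  ultimately show ?thesis using Z by blast
qed

theorem proposition3p1:
  fixes X :: "'a set" and d :: "'a \<Rightarrow> 'a \<Rightarrow> real"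
  assumes "Metric_space X d"
  shows "asrk X d =
    Sup {enat n |n. \<exists>(V :: (nat \<Rightarrow>\<^sub>0 real) set) N (S :: nat \<Rightarrow> 'a set) (R :: nat \<Rightarrow> real).
           normed_space_of_dim n V N \<and>
           (\<forall>j. S j \<subseteq> X) \<and> (\<forall>j. 0 < R j) \<and> filterlim R at_top sequentially \<and>
           gh_converges S (\<lambda>j x y. inverse (R j) * d x y)
             (closed_unit_ball V N) (\<lambda>v w. N (v - w))}"
  unfolding asrk_def
proof (rule arg_cong[where f = Sup], rule Collect_cong, rule ex_cong1, rule conj_cong[OF refl], rule iffI, goal_cases)
  case 1
  then show ?case by (elim exE conjE) (rule bilipschitz_image_imp_ball_limit[OF assms])
next
  case 2
  then show ?case by (elim exE conjE) (rule ball_limit_imp_bilipschitz_image)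
qed

end
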